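(* Let $G=\mathbb{Z}/p\mathbb{Z}$ with $p\geq 2$ a prime, let $\beta\in[0.731,1]$ and $\alpha\in(0,0.212]$ be real numbers, let $A,B\subseteq G$ be nonempty subsets, and set $C=-\,(G\setminus(A+B))$. Suppose, with $r$ the integer defined by $|A+B|=|A|+|B|+r$, $$|A+B|=|A|+|B|+r\leq |A|+(1+\alpha)|B|-3\quad\text{and}\quad \beta|A|\leq|B|\leq|A|\leq\min\{c_1,c_\beta\}\,p,$$ where $$c_1=\frac{5-18\alpha-24\alpha^2-8\alpha^3}{14-9\alpha-24\alpha^2-8\alpha^3}$$ and $$c_\beta=\frac{-4-(1+12\alpha)\beta+3(5+\alpha-4\alpha^2)\beta^{2}+(-1+3\alpha-4\alpha^3)\beta^{3}-4(1+\alpha)^3\beta^{4}}{-4+11\beta^{2}+11\beta^{3}-4\beta^{5}-3\alpha\beta(4-5\beta^{2}+4\beta^{4})-12\alpha^2(\beta^{2}+\beta^{5})-4\alpha^3(\beta^{3}+\beta^{5})}.$$ Then there are arithmetic progressions $P_A,P_B,P_C\subseteq G$, all having a common difference, such that $X\subseteq P_X$ and $|P_X|\leq|X|+r+1$ for all $X\in\{A,B,C\}$.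
   Context: An arithmetic progression in $G$ with difference $d$ is a set $\{a,a+d,\dots,a+(n-1)d\}$. *)

theory Defs
  imports
    Complex_Main
    "Berlekamp_Zassenhaus.Finite_Field"
    "HOL-Library.Set_Algebras"
begin

(* The group Z/pZ is the type 'p mod_ring with 'p :: prime_card, where p = CARD('p) is prime.
   Sums of sets are those of Set_Algebras; note that for sets "- S" is the complement, so the
   set of negatives is written uminus ` S. *)

(* Progressions are regarded as sets: the terms a, a + d, ... need not be distinct. *)
definition arith_prog :: "'a::ring_1 \<Rightarrow> 'a set \<Rightarrow> bool" where
  "arith_prog d P \<longleftrightarrow> (\<exists>a n. n \<ge> 1 \<and> P = {a + of_nat i * d | i. i \<le> n - 1})"

definition c_one :: "real \<Rightarrow> real" where
  "c_one \<alpha> = (5 - 18 * \<alpha> - 24 * \<alpha>^2 - 8 * \<alpha>^3) / (14 - 9 * \<alpha> - 24 * \<alpha>^2 - 8 * \<alpha>^3)"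

definition c_beta :: "real \<Rightarrow> real \<Rightarrow> real" where
  "c_beta \<alpha> \<beta> =
     (- 4 - (1 + 12 * \<alpha>) * \<beta> + 3 * (5 + \<alpha> - 4 * \<alpha>^2) * \<beta>^2
        + (- 1 + 3 * \<alpha> - 4 * \<alpha>^3) * \<beta>^3 - 4 * (1 + \<alpha>)^3 * \<beta>^4)
     / (- 4 + 11 * \<beta>^2 + 11 * \<beta>^3 - 4 * \<beta>^5 - 3 * \<alpha> * \<beta> * (4 - 5 * \<beta>^2 + 4 * \<beta>^4)
        - 12 * \<alpha>^2 * (\<beta>^2 + \<beta>^5) - 4 * \<alpha>^3 * (\<beta>^3 + \<beta>^5))"

end

theory Submission
  imports Defs "HOL-Analysis.Henstock_Kurzweil_Integration"
begin

text \<open>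
  Write \<open>a\<close>, \<open>b\<close>, \<open>s\<close> for the sizes of \<open>A\<close>, \<open>B\<close>, \<open>A + B\<close>. If no nontrivial character had both a large
  Fourier coefficient at \<open>A\<close> and one at \<open>B\<close>, then splitting the characters accordingly and applying
  Cauchy--Schwarz to the sum of the products of the coefficients of \<open>A\<close>, \<open>B\<close> and \<open>A + B\<close> would contradict
  the upper bound on \<open>a\<close>; the constants \<open>c\<^sub>1\<close> and \<open>c\<^sub>\<beta>\<close> are exactly this condition at \<open>b = a\<close> and
  \<open>b = \<beta> a\<close>, and it is concave in between. A large coefficient puts many elements on a half circle, so
  after a dilation more than \<open>(s + 3) / 3\<close> elements of each of \<open>A\<close> and \<open>B\<close> lie in intervals of length
  \<open>(p + 1) / 2\<close>, whose sumset can be computed in the integers.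

  There the \<open>3k - 4\<close> theorem for distinct summands applies. Its diameter bound follows from Kneser's theorem
  modulo the larger diameter, and it provides a long interval in the sumset. Since \<open>0 \<notin> A + B + C\<close>, this
  interval confines \<open>C\<close> to a short interval; the argument is repeated for \<open>A'\<close> and \<open>C\<close>, which confines \<open>B\<close>,
  and then for \<open>B\<close> and \<open>C\<close>, which confines \<open>A\<close> and gives the final bounds.
\<close>

section \<open>Kneser's theorem\<close>

definition add_subgroup :: "'a::ab_group_add set \<Rightarrow> bool" where
  "add_subgroup H \<longleftrightarrow> 0 \<in> H \<and> (\<forall>x\<in>H. \<forall>y\<in>H. x - y \<in> H)"

text \<open>For a subgroup \<open>H\<close> the periodic sets are the unions of cosets of
  \<open>H\<close>.\<close>

definition periodic :: "'a::ab_group_add set \<Rightarrow> 'a set \<Rightarrow> bool" where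
  "periodic H S \<longleftrightarrow> (\<forall>x\<in>S. \<forall>h\<in>H. x + h \<in> S)"

lemma add_subgroup_zero: "add_subgroup H \<Longrightarrow> 0 \<in> H"
  by (simp add: add_subgroup_def)

lemma add_subgroup_diff: "add_subgroup H \<Longrightarrow> x \<in> H \<Longrightarrow> y \<in> H \<Longrightarrow> x - y \<in> H"
  by (simp add: add_subgroup_def)

lemma add_subgroup_minus: "add_subgroup H \<Longrightarrow> x \<in> H \<Longrightarrow> - x \<in> H"
  using add_subgroup_diff[of H 0 x] add_subgroup_zero[of H] by simp

lemma add_subgroup_add: "add_subgroup H \<Longrightarrow> x \<in> H \<Longrightarrow> y \<in> H \<Longrightarrow> x + y \<in> H"
  using add_subgroup_diff[of H x "- y"] add_subgroup_minus[of H y] by simp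

lemma add_subgroup_Int: "add_subgroup H \<Longrightarrow> add_subgroup K \<Longrightarrow> add_subgroup (H \<inter> K)"
  by (simp add: add_subgroup_def)

lemma periodic_iff:
  assumes "add_subgroup H" "periodic H S" "h \<in> H"
  shows "x + h \<in> S \<longleftrightarrow> x \<in> S"
  using assms add_subgroup_minus[of H h] unfolding periodic_def
  by (metis add.assoc add.right_inverse add.right_neutral)

lemma periodic_Un:
  "periodic H S \<Longrightarrow> periodic K T \<Longrightarrow> periodic (H \<inter> K) (S \<union> T)"
  by (auto simp: periodic_def)

lemma card_fibres_le:
  assumes "finite X" "finite Y" "f ` X \<subseteq> Y" "\<And>y. y \<in> Y \<Longrightarrow> card {x\<in>X. f x = y} \<le> k"
  shows "card X \<le> k * card Y"
proof -
  have "X = (\<Union>y\<in>Y. {x\<in>X. f x = y})" using assms(3) by auto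
  then have "card X \<le> (\<Sum>y\<in>Y. card {x\<in>X. f x = y})"
    using card_UN_le[OF assms(2)] by metis
  also have "\<dots> \<le> (\<Sum>y\<in>Y. k)" by (rule sum_mono) (rule assms(4))
  finally show ?thesis by (simp add: mult.commute)
qed

text \<open>One element of \<open>S\<close> in the coset \<open>c + H\<close> brings along its
  translates by \<open>K\<close>, which stay both in the coset and in \<open>S\<close>. So a
  nonempty part of a coset has at least \<open>card K\<close> elements.\<close>

lemma card_coset_le:
  assumes H: "add_subgroup H" "finite H" and K: "K = H \<inter> L" "add_subgroup L"
    and per: "periodic L S" and h: "h \<in> H" "c + h \<in> S"
  shows "card K \<le> card {h \<in> H. c + h \<in> S}"
proof (rule card_inj_on_le)
  show "inj_on (\<lambda>k. h + k) K" by simp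
  show "(\<lambda>k. h + k) ` K \<subseteq> {h \<in> H. c + h \<in> S}"
    using assms by (auto simp: periodic_def add_subgroup_add simp flip: add.assoc)
qed (use H in simp)

text \<open>Within a coset of \<^term>\<open>H + L\<close>, seen as a grid whose rows and columns are the cosets of
  \<^term>\<open>H\<close> and \<^term>\<open>L\<close>, the set \<^term>\<open>C - D\<close> contains a product set.\<close>

lemma card_grid_le:
  fixes H L :: "'a::ab_group_add set"
  assumes H: "add_subgroup H" "finite H" and L: "add_subgroup L" "finite L"
    and C: "periodic H C" and D: "periodic L D" and fin: "finite C"
  shows "card {h \<in> H. c + h \<notin> D} * card {l \<in> L. c + l \<in> C} \<le> card (H \<inter> L) * card (C - D)"
proof -
  let ?X = "{h \<in> H. c + h \<notin> D}" and ?Y = "{l \<in> L. c + l \<in> C}"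
  have "card (?X \<times> ?Y) \<le> card (H \<inter> L) * card (C - D)"
  proof (rule card_fibres_le[where f = "\<lambda>(h, l). c + h + l"])
    show "(\<lambda>(h, l). c + h + l) ` (?X \<times> ?Y) \<subseteq> C - D"
    proof clarify
      fix h l assume a: "h \<in> H" "c + h \<notin> D" "l \<in> L" "c + l \<in> C"
      have "c + h + l \<notin> D" using periodic_iff[OF L(1) D a(3), of "c + h"] a(2) by simp
      moreover have "c + h + l \<in> C"
        using periodic_iff[OF H(1) C a(1), of "c + l"] a(4) by (simp add: ac_simps)
      ultimately show "c + h + l \<in> C - D" by simp
    qed
    fix y
    show "card {x \<in> ?X \<times> ?Y. (case x of (h, l) \<Rightarrow> c + h + l) = y} \<le> card (H \<inter> L)" (is "card ?F \<le> _")
    proof (cases "?F = {}")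
      case False
      then obtain h0 l0 where 0: "h0 \<in> H" "l0 \<in> L" "c + h0 + l0 = y" by auto
      \<comment> \<open>Two representations \<open>c + h + l\<close> and \<open>c + h0 + l0\<close>
        of the same point satisfy \<open>h - h0 = l0 - l\<close>, an element of both subgroups, and
        \<open>h\<close> determines \<open>l\<close>.\<close>
      have "inj_on (\<lambda>(h, l). h - h0) ?F"
        by (rule inj_onI) (auto split: prod.splits)
      moreover have "(\<lambda>(h, l). h - h0) ` ?F \<subseteq> H \<inter> L"
      proof clarify
        fix h l assume a: "h \<in> H" "l \<in> L" "y = c + h + l"
        then have "h - h0 = l0 - l" using 0 by (simp add: algebra_simps)
        then show "h - h0 \<in> H \<inter> L" using a 0 H L by (metis IntI add_subgroup_diff)
      qed
      ultimately show ?thesis by (intro card_inj_on_le) (use H in auto)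
    qed (metis card.empty zero_le)
  qed (use H L fin in auto)
  then show ?thesis by (simp add: card_cartesian_product)
qed

text \<open>Let \<open>x\<close> and \<open>x'\<close> count the points of \<open>c + H\<close>
  outside and inside \<open>D\<close>, and \<open>y\<close> and \<open>y'\<close> those of
  \<open>c + L\<close> inside and outside \<open>C\<close>. The grid bounds turn the hypotheses into
  \<open>(x - \<kappa>) * y < \<kappa> * (y' - \<kappa>)\<close> and
  \<open>(y' - \<kappa>) * x' < \<kappa> * (x - \<kappa>)\<close>. Since
  \<open>y \<ge> \<kappa>\<close>, the first gives \<open>x < y'\<close>. A nonzero
  \<open>x'\<close> is at least \<open>\<kappa>\<close>, and the second would give
  \<open>y' < x\<close>. So \<open>x' = 0\<close> and
  \<open>card H = x < y' \<le> card L\<close>.\<close>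

lemma card_subgroup_less:
  fixes H L :: "'a::ab_group_add set"
  assumes H: "add_subgroup H" "finite H" and L: "add_subgroup L" "finite L"
    and C: "periodic H C" and D: "periodic L D" and fin: "finite C" "finite D"
    and c: "c \<in> C - D"
    and CD: "card (C - D) + card (H \<inter> L) < card L"
    and DC: "card (D - C) + card (H \<inter> L) < card H"
  shows "card H < card L"
proof -
  define \<kappa> where "\<kappa> = card (H \<inter> L)"
  define x where "x = card {h \<in> H. c + h \<notin> D}"
  define x' where "x' = card {h \<in> H. c + h \<in> D}"
  define y where "y = card {l \<in> L. c + l \<in> C}"
  define y' where "y' = card {l \<in> L. c + l \<notin> C}"
  have xx: "x + x' = card H" unfolding x_def x'_def
    by (subst card_Un_disjoint[symmetric]) (use H in \<open>auto intro: arg_cong[where f=card]\<close>)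
  have yy: "y + y' = card L" unfolding y_def y'_def
    by (subst card_Un_disjoint[symmetric]) (use L in \<open>auto intro: arg_cong[where f=card]\<close>)
  have \<kappa>: "\<kappa> > 0" unfolding \<kappa>_def
    using H L add_subgroup_zero[of H] add_subgroup_zero[of L] by (auto simp: card_gt_0_iff)
  have D': "periodic L (- D)" unfolding periodic_def using periodic_iff[OF L(1) D] by auto
  have x\<kappa>: "\<kappa> \<le> x" unfolding \<kappa>_def x_def
    using card_coset_le[OF H refl L(1) D', of 0 c] c add_subgroup_zero[OF H(1)] by simp
  have y\<kappa>: "\<kappa> \<le> y" unfolding \<kappa>_def y_def
    using card_coset_le[OF L refl H(1) C, of 0 c] c add_subgroup_zero[OF L(1)] by (simp add: Int_commute)
  have x'\<kappa>: "\<kappa> \<le> x'" if "x' \<noteq> 0"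
  proof -
    from that obtain h where "h \<in> H" "c + h \<in> D" unfolding x'_def by (metis (no_types, lifting) card.empty empty_Collect_eq)
    then show ?thesis unfolding \<kappa>_def x'_def using card_coset_le[OF H refl L(1) D] by blast
  qed
  have g1: "x * y \<le> \<kappa> * card (C - D)"
    unfolding x_def y_def \<kappa>_def by (rule card_grid_le) (use assms in auto)
  have g2: "y' * x' \<le> \<kappa> * card (D - C)"
    unfolding x'_def y'_def \<kappa>_def Int_commute[of H] by (rule card_grid_le) (use assms in auto)
  have CD': "int (card (C - D)) < int y + y' - \<kappa>" using CD yy unfolding \<kappa>_def by linarith
  have DC': "int (card (D - C)) < int x + x' - \<kappa>" using DC xx unfolding \<kappa>_def by linarith
  have "int x * y \<le> \<kappa> * int (card (C - D))" using g1 by (metis of_nat_le_iff of_nat_mult)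
  also have "\<dots> < \<kappa> * (int y + y' - \<kappa>)" using CD' \<kappa> by (intro mult_strict_left_mono) auto
  finally have 1: "(int x - \<kappa>) * y < \<kappa> * (int y' - \<kappa>)" by (simp add: algebra_simps)
  have "int y' * x' \<le> \<kappa> * int (card (D - C))" using g2 by (metis of_nat_le_iff of_nat_mult)
  also have "\<dots> < \<kappa> * (int x + x' - \<kappa>)" using DC' \<kappa> by (intro mult_strict_left_mono) auto
  finally have 2: "(int y' - \<kappa>) * x' < \<kappa> * (int x - \<kappa>)" by (simp add: algebra_simps)
  have "\<kappa> * (int x - \<kappa>) \<le> (int x - \<kappa>) * y"
    using x\<kappa> y\<kappa> by (metis (no_types) diff_ge_0_iff_ge mult.commute mult_left_mono of_nat_le_iff)
  then have 3: "x < y'" using 1 \<kappa> by (smt (verit) mult_le_cancel_left of_nat_0_less_iff of_nat_less_iff)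
  show ?thesis
  proof (cases "x' = 0")
    case True
    then show ?thesis using xx yy 3 by linarith
  next
    case False
    have "(int y' - \<kappa>) * \<kappa> \<le> (int y' - \<kappa>) * x'"
      using x'\<kappa>[OF False] 3 x\<kappa> by (intro mult_left_mono) auto
    then have "\<kappa> * (int y' - \<kappa>) \<le> (int y' - \<kappa>) * x'" by (simp add: mult.commute)
    then have "y' < x" using 2 \<kappa> by (smt (verit) mult_le_cancel_left of_nat_0_less_iff of_nat_less_iff)
    then show ?thesis using 3 by simp
  qed
qed

text \<open>\<open>N\<close> stands for \<open>card A + card B\<close> in Kneser's theorem. If
  neither set contains the other, \<open>H \<inter> L\<close> serves as \<open>K\<close>: otherwise
  \<open>card_subgroup_less\<close>, applied in both orders, would give both
  \<open>card H < card L\<close> and \<open>card L < card H\<close>.\<close>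

lemma periodic_union:
  fixes C D :: "'a::ab_group_add set"
  assumes H: "add_subgroup H" "finite H" and L: "add_subgroup L" "finite L"
    and C: "periodic H C" and D: "periodic L D" and fin: "finite C" "finite D"
    and N: "N \<le> card C + card H" "N \<le> card D + card L"
  shows "\<exists>K. add_subgroup K \<and> finite K \<and> periodic K (C \<union> D) \<and> N \<le> card (C \<union> D) + card K"
proof (cases "C \<subseteq> D \<or> D \<subseteq> C")
  case True
  then show ?thesis using assms by (metis sup.absorb1 sup.absorb2)
next
  case False
  then obtain c d where cd: "c \<in> C - D" "d \<in> D - C" by auto
  have "card H \<le> card (D - C) + card (H \<inter> L) \<or> card L \<le> card (C - D) + card (H \<inter> L)"
    using card_subgroup_less[OF H L C D fin cd(1)] card_subgroup_less[OF L H D C fin(2,1) cd(2)]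
    unfolding Int_commute[of L H] by linarith
  moreover have "card (C \<union> D) = card C + card (D - C)" "card (C \<union> D) = card D + card (C - D)"
    using fin card_Un_disjoint[of C "D - C"] card_Un_disjoint[of D "C - D"] by (auto simp: Un_commute)
  ultimately have "N \<le> card (C \<union> D) + card (H \<inter> L)" using N by linarith
  then show ?thesis
    using periodic_Un[OF C D] add_subgroup_Int[OF H(1) L(1)] H(2) by blast
qed

section \<open>Stabilizers, and Kneser's theorem from its local form\<close>

definition stabilizer :: "'a::ab_group_add set \<Rightarrow> 'a set" where
  "stabilizer S = {h. \<forall>x. x + h \<in> S \<longleftrightarrow> x \<in> S}"

lemma add_subgroup_stabilizer: "add_subgroup (stabilizer S)"
proof -
  have "x + (g - h) \<in> S \<longleftrightarrow> x \<in> S" if "g \<in> stabilizer S" "h \<in> stabilizer S" for g h x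
  proof -
    have "x + (g - h) \<in> S \<longleftrightarrow> x - h \<in> S"
    proof -
      have "(x - h) + g \<in> S \<longleftrightarrow> x - h \<in> S" using that(1) unfolding stabilizer_def by blast
      then show ?thesis by (simp add: algebra_simps)
    qed
    also have "\<dots> \<longleftrightarrow> x \<in> S"
    proof -
      have "(x - h) + h \<in> S \<longleftrightarrow> x - h \<in> S" using that(2) unfolding stabilizer_def by blast
      then show ?thesis by simp
    qed
    finally show ?thesis .
  qed
  then show ?thesis by (simp add: add_subgroup_def stabilizer_def)
qed

lemma periodic_stabilizer: "periodic (stabilizer S) S"
  by (auto simp: periodic_def stabilizer_def)

lemma subset_stabilizer: "add_subgroup K \<Longrightarrow> periodic K S \<Longrightarrow> K \<subseteq> stabilizer S"
  by (auto simp: stabilizer_def periodic_iff)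

lemma finite_stabilizer:
  assumes "finite S" "S \<noteq> {}" shows "finite (stabilizer S)"
proof -
  obtain s where s: "s \<in> S" using assms by auto
  have "(\<lambda>h. s + h) ` stabilizer S \<subseteq> S" using s by (auto simp: stabilizer_def)
  then show ?thesis using assms(1) by (meson finite_imageD finite_subset inj_on_add)
qed

text \<open>Translation by \<open>h\<close> is injective, so it maps the finite set \<open>S\<close>
  onto itself, which gives the converse implication.\<close>

lemma mem_stabilizer_finite:
  assumes "finite S" "\<And>x. x \<in> S \<Longrightarrow> x + h \<in> S"
  shows "h \<in> stabilizer S"
proof -
  have im: "(\<lambda>x. x + h) ` S = S"
    by (rule card_subset_eq) (use assms in \<open>auto simp: card_image\<close>)
  have "x \<in> S" if "x + h \<in> S" for x
  proof -
    have "x + h \<in> (\<lambda>x. x + h) ` S" using that im by simp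
    then show ?thesis by auto
  qed
  then show ?thesis using assms(2) unfolding stabilizer_def by blast
qed

text \<open>Dyson's transform replaces \<open>A\<close>, \<open>B\<close> by \<open>A \<union> (B + e)\<close> and \<open>B \<inter> (A - e)\<close>.\<close>

lemma Kneser_local_zero:
  fixes A B :: "'a::ab_group_add set"
  assumes "finite A" "finite B" "0 \<in> A" "0 \<in> B"
  shows "\<exists>C K. 0 \<in> C \<and> C \<subseteq> A + B \<and> add_subgroup K \<and> finite K \<and> periodic K C
    \<and> card A + card B \<le> card C + card K"
  using assms
proof (induction "card B" arbitrary: A B rule: less_induct)
  case less
  show ?case
  proof (cases "\<forall>e\<in>A. \<forall>b\<in>B. e + b \<in> A")
    case True
    \<comment> \<open>Here no transform enlarges \<open>A\<close>:
      \<open>A + B \<subseteq> A\<close>, and \<open>A\<close> with its own stabilizer is the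
      required periodic piece.\<close>
    have "B \<subseteq> stabilizer A" using True less.prems by (auto intro: mem_stabilizer_finite)
    moreover have fs: "finite (stabilizer A)" using less.prems finite_stabilizer by auto
    ultimately have "card B \<le> card (stabilizer A)" by (simp add: card_mono)
    moreover have "A \<subseteq> A + B" using less.prems by (force simp: set_plus_def)
    ultimately show ?thesis
      using less.prems fs periodic_stabilizer[of A] add_subgroup_stabilizer[of A] by (intro exI[of _ A] exI[of _ "stabilizer A"]) auto
  next
    case False
    then obtain e b where eb: "e \<in> A" "b \<in> B" "e + b \<notin> A" by auto
    define A1 where "A1 = A \<union> (\<lambda>x. e + x) ` B"
    define B1 where "B1 = {x \<in> B. e + x \<in> A}"
    have fin: "finite A1" "finite B1" using less.prems by (auto simp: A1_def B1_def)
    \<comment> \<open>As \<open>e + b \<notin> A\<close>, the transform removes \<open>b\<close>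
      from \<open>B\<close>, so the induction on \<open>card B\<close> proceeds, while the total
      size of the pair is preserved.\<close>
    have lt: "card B1 < card B" using eb less.prems by (intro psubset_card_mono) (auto simp: B1_def)
    have "A \<inter> (\<lambda>x. e + x) ` B = (\<lambda>x. e + x) ` B1" by (auto simp: B1_def)
    then have "card (A \<inter> (\<lambda>x. e + x) ` B) = card B1" by (simp add: card_image)
    then have eq: "card A1 + card B1 = card A + card B"
      using card_Un_Int[of A "(\<lambda>x. e + x) ` B"] less.prems by (simp add: A1_def card_image)
    have sub: "A1 + B1 \<subseteq> A + B"
    proof
      fix z assume "z \<in> A1 + B1"
      then obtain x y where xy: "x \<in> A1" "y \<in> B" "e + y \<in> A" "z = x + y"
        by (auto simp: B1_def set_plus_def)
      show "z \<in> A + B"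
      proof (cases "x \<in> A")
        case True then show ?thesis using xy by (auto intro: set_plus_intro)
      next
        case False
        then obtain b' where "b' \<in> B" "x = e + b'" using xy by (auto simp: A1_def)
        \<comment> \<open>The summands are exchanged: \<open>e + y\<close> is in \<open>A\<close> by
          the definition of \<open>B1\<close>, and \<open>b'\<close> is in \<open>B\<close>.\<close>
        then have "z = (e + y) + b'" using xy by (simp add: ac_simps)
        then show ?thesis using xy(3) \<open>b' \<in> B\<close> set_plus_intro by metis
      qed
    qed
    have "0 \<in> A1" "0 \<in> B1" using less.prems eb by (auto simp: A1_def B1_def)
    from less.hyps[OF lt fin this] eq sub show ?thesis by (metis order_trans)
  qed
qed

lemma set_plus_translate:
  fixes A B :: "'a::ab_group_add set"
  shows "(\<lambda>x. x - a) ` A + (\<lambda>x. x - b) ` B = (\<lambda>x. x - (a + b)) ` (A + B)"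
  by (force simp: set_plus_def image_iff algebra_simps)

text \<open>Translating \<open>A\<close> and \<open>B\<close> moves \<open>c = a + b\<close> to 0,
  where \<open>Kneser_local_zero\<close> applies.\<close>

lemma Kneser_local:
  fixes A B :: "'a::ab_group_add set"
  assumes "finite A" "finite B" "c \<in> A + B"
  shows "\<exists>C K. c \<in> C \<and> C \<subseteq> A + B \<and> add_subgroup K \<and> finite K \<and> periodic K C
    \<and> card A + card B \<le> card C + card K"
proof -
  obtain a b where ab: "a \<in> A" "b \<in> B" "c = a + b" using assms(3) by (auto simp: set_plus_def)
  have card: "card ((\<lambda>x. x - a) ` A) = card A" "card ((\<lambda>x. x - b) ` B) = card B"
    by (auto simp: card_image inj_on_def)
  obtain C K where CK: "0 \<in> C" "C \<subseteq> (\<lambda>x. x - c) ` (A + B)" "add_subgroup K" "finite K" "periodic K C"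
    "card A + card B \<le> card C + card K"
    using Kneser_local_zero[of "(\<lambda>x. x - a) ` A" "(\<lambda>x. x - b) ` B"] assms ab
    unfolding card set_plus_translate by (auto simp: image_iff)
  have "c \<in> (\<lambda>x. x + c) ` C" using CK(1) by force
  moreover have "(\<lambda>x. x + c) ` C \<subseteq> A + B" using CK(2) by force
  moreover have "periodic K ((\<lambda>x. x + c) ` C)"
    using CK(5) by (force simp: periodic_def image_iff algebra_simps)
  moreover have "card ((\<lambda>x. x + c) ` C) = card C" by (simp add: card_image)
  ultimately show ?thesis using CK by metis
qed

text \<open>The local pieces around the elements of the finite set \<open>A + B\<close> are merged
  one by one with \<open>periodic_union\<close>. The last union is \<open>A + B\<close> itself, and
  its subgroup lies in the stabilizer.\<close>

lemma Kneser_weak: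
  fixes A B :: "'a::ab_group_add set"
  assumes fin: "finite A" "finite B" and ne: "A \<noteq> {}" "B \<noteq> {}"
  shows "card A + card B \<le> card (A + B) + card (stabilizer (A + B))"
proof -
  have fS: "finite (A + B)" and nS: "A + B \<noteq> {}" using assms by (auto simp: finite_set_plus set_plus_def)
  have "\<exists>C K. T \<subseteq> C \<and> C \<subseteq> A + B \<and> add_subgroup K \<and> finite K \<and> periodic K C
    \<and> card A + card B \<le> card C + card K" if "finite T" "T \<noteq> {}" "T \<subseteq> A + B" for T
    using that
  proof (induction rule: finite_ne_induct)
    case (singleton x)
    then show ?case using Kneser_local[OF fin, of x] by auto
  next
    case (insert x F)
    obtain C K where 1: "F \<subseteq> C" "C \<subseteq> A + B" "add_subgroup K" "finite K" "periodic K C"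
      "card A + card B \<le> card C + card K" using insert by auto
    obtain D L where 2: "x \<in> D" "D \<subseteq> A + B" "add_subgroup L" "finite L" "periodic L D"
      "card A + card B \<le> card D + card L" using Kneser_local[OF fin, of x] insert by auto
    have "finite C" "finite D" using 1(2) 2(2) fS by (auto intro: finite_subset)
    then obtain M where "add_subgroup M" "finite M" "periodic M (C \<union> D)"
      "card A + card B \<le> card (C \<union> D) + card M"
      using periodic_union[OF 1(3,4) 2(3,4) 1(5) 2(5) _ _ 1(6) 2(6)] by blast
    then show ?case using 1 2 by (intro exI[of _ "C \<union> D"] exI[of _ M]) auto
  qed
  from this[OF fS nS order_refl] obtain K where K: "add_subgroup K" "periodic K (A + B)"
      "card A + card B \<le> card (A + B) + card K" by (metis subset_antisym)
  have "card K \<le> card (stabilizer (A + B))"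
    using subset_stabilizer[OF K(1,2)] finite_stabilizer[OF fS nS] by (simp add: card_mono)
  then show ?thesis using K by linarith
qed

text \<open>The weak form is applied to \<open>A + H\<close> and \<open>B + H\<close>, whose sumset
  is again \<open>A + B\<close> and so has the same stabilizer.\<close>

theorem Kneser:
  fixes A B :: "'a::ab_group_add set"
  assumes fin: "finite A" "finite B" and ne: "A \<noteq> {}" "B \<noteq> {}"
  defines "H \<equiv> stabilizer (A + B)"
  shows "card (A + H) + card (B + H) \<le> card (A + B) + card H"
proof -
  have H: "add_subgroup H" "finite H" unfolding H_def
    using add_subgroup_stabilizer finite_stabilizer[of "A + B"] assms by (auto simp: finite_set_plus set_plus_def)
  have H0: "0 \<in> H" by (rule add_subgroup_zero[OF H(1)])
  have HH: "H + H = H"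
  proof
    show "H + H \<subseteq> H" using add_subgroup_add[OF H(1)] by (auto simp: set_plus_def)
    show "H \<subseteq> H + H"
    proof
      fix x assume "x \<in> H"
      then have "x + 0 \<in> H + H" using H0 by (rule set_plus_intro)
      then show "x \<in> H + H" by simp
    qed
  qed
  have SH: "A + B + H = A + B"
  proof
    show "A + B + H \<subseteq> A + B"
    proof
      fix x assume "x \<in> A + B + H"
      then obtain y h where "y \<in> A + B" "h \<in> H" "x = y + h" by (rule set_plus_elim)
      then show "x \<in> A + B" using periodic_stabilizer[of "A + B"] unfolding H_def periodic_def by simp
    qed
    show "A + B \<subseteq> A + B + H"
    proof
      fix x assume "x \<in> A + B"
      then have "x + 0 \<in> A + B + H" using H0 by (rule set_plus_intro)
      then show "x \<in> A + B + H" by simp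
    qed
  qed
  have "(A + H) + (B + H) = A + B + (H + H)" by (simp add: ac_simps)
  then have eq: "(A + H) + (B + H) = A + B" using HH SH by simp
  have ne': "X + H \<noteq> {}" if "X \<noteq> {}" for X
    using that H0 set_plus_intro[of _ X 0 H] by fastforce
  show ?thesis
    using Kneser_weak[of "A + H" "B + H"] fin ne' ne H(2) unfolding eq H_def[symmetric]
    by (simp add: finite_set_plus)
qed

section \<open>Sumsets of integers\<close>

lemma Ints_minus_flip: "x - y \<in> \<int> \<Longrightarrow> y - x \<in> \<int>" for x y :: real
  using Ints_minus[of "x - y"] by simp

text \<open>The circle group contains a copy of every finite cyclic group, so that Kneser's theorem can be
  applied modulo an integer that is not fixed by a type.\<close>

quotient_type circle = real / "\<lambda>x y. x - y \<in> \<int>"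
proof (rule equivpI)
  show "reflp (\<lambda>x y::real. x - y \<in> \<int>)" by (simp add: reflp_def)
  show "symp (\<lambda>x y::real. x - y \<in> \<int>)" by (rule sympI) (rule Ints_minus_flip)
  show "transp (\<lambda>x y::real. x - y \<in> \<int>)"
  proof (rule transpI)
    fix x y z :: real
    assume "x - y \<in> \<int>" "y - z \<in> \<int>"
    then have "(x - y) + (y - z) \<in> \<int>" by (rule Ints_add)
    then show "x - z \<in> \<int>" by simp
  qed
qed

instantiation circle :: ab_group_add
begin
lift_definition zero_circle :: circle is 0 .
lift_definition plus_circle :: "circle \<Rightarrow> circle \<Rightarrow> circle" is "(+)"
proof -
  fix x x' y y' :: real
  assume "x - x' \<in> \<int>" "y - y' \<in> \<int>"
  then have "(x - x') + (y - y') \<in> \<int>" by (rule Ints_add)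
  then show "x + y - (x' + y') \<in> \<int>" by (simp add: algebra_simps)
qed
lift_definition uminus_circle :: "circle \<Rightarrow> circle" is uminus
  using Ints_minus_flip by (simp add: minus_diff_commute)
lift_definition minus_circle :: "circle \<Rightarrow> circle \<Rightarrow> circle" is "(-)"
proof -
  fix x x' y y' :: real
  assume "x - x' \<in> \<int>" "y - y' \<in> \<int>"
  then have "(x - x') - (y - y') \<in> \<int>" by (rule Ints_diff)
  then show "x - y - (x' - y') \<in> \<int>" by (simp add: algebra_simps)
qed
instance by standard (transfer; simp)+
end

text \<open>For \<open>n > 0\<close> this is a homomorphism whose kernel consists of the multiples
  of \<open>n\<close>, so its image is cyclic of order \<open>n\<close>.\<close>

lift_definition circle_of :: "nat \<Rightarrow> int \<Rightarrow> circle" is "\<lambda>n x. of_int x / of_nat n" .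

lemma circle_of_add: "circle_of n (x + y) = circle_of n x + circle_of n y"
  by transfer (simp add: add_divide_distrib)

lemma circle_of_0: "circle_of n 0 = 0"
  by transfer simp

lemma circle_of_eq_iff:
  assumes "n > 0" shows "circle_of n x = circle_of n y \<longleftrightarrow> x mod int n = y mod int n"
proof -
  have "circle_of n x = circle_of n y \<longleftrightarrow> real_of_int x / n - real_of_int y / n \<in> \<int>"
    by transfer simp
  also have "\<dots> \<longleftrightarrow> (\<exists>k. real_of_int x / n - real_of_int y / n = real_of_int k)"
    by (auto elim: Ints_cases)
  also have "\<dots> \<longleftrightarrow> (\<exists>k. real_of_int (x - y) = real_of_int (int n * k))"
    using assms by (simp add: field_simps)
  also have "\<dots> \<longleftrightarrow> (\<exists>k. x - y = int n * k)" unfolding of_int_eq_iff ..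
  also have "\<dots> \<longleftrightarrow> x mod int n = y mod int n" unfolding mod_eq_dvd_iff dvd_def ..
  finally show ?thesis .
qed

section \<open>Counting integer sumsets modulo their diameter\<close>

text \<open>The translates \<open>Min A + B\<close> and \<open>A + Max B\<close> have at most one
  element in common.\<close>

lemma card_sumset_ge:
  fixes A B :: "int set"
  assumes "finite A" "finite B" "A \<noteq> {}" "B \<noteq> {}"
  shows "card A + card B \<le> card (A + B) + 1"
proof -
  let ?L = "(\<lambda>b. Min A + b) ` B" and ?R = "(\<lambda>a. a + Max B) ` A"
  have "?L \<inter> ?R \<subseteq> {Min A + Max B}"
  proof
    fix x assume "x \<in> ?L \<inter> ?R"
    then obtain a b where a: "b \<in> B" "a \<in> A" "x = Min A + b" "x = a + Max B" by auto
    have "Min A \<le> a" "b \<le> Max B" using a assms by auto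
    then show "x \<in> {Min A + Max B}" using a by auto
  qed
  then have "card (?L \<inter> ?R) \<le> 1" by (metis card.empty card_insert_disjoint card_mono empty_iff finite.emptyI finite.insertI One_nat_def)
  moreover have "card (?L \<union> ?R) \<le> card (A + B)"
    using assms by (intro card_mono finite_set_plus Un_least image_subsetI set_plus_intro) simp_all
  moreover have "card ?L = card B" "card ?R = card A" by (auto simp: card_image)
  ultimately show ?thesis using card_Un_Int[of ?L ?R] assms by simp
qed

text \<open>The largest element of a fibre of \<^term>\<open>f\<close> in \<^term>\<open>S\<close> is not in \<^term>\<open>X\<close>, so that
  \<^term>\<open>f\<close> maps \<^term>\<open>S - X\<close> onto \<^term>\<open>f ` S\<close>.\<close>

lemma card_shift_ge:
  fixes S X :: "int set" and n :: int
  assumes S: "finite S" and n: "n > 0" and f: "\<And>x. f (x + n) = f x"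
    and X: "X \<subseteq> S" "(\<lambda>x. x + n) ` X \<subseteq> S"
  shows "card X + card (f ` S) \<le> card S"
proof -
  have "f ` S \<subseteq> f ` (S - X)"
  proof clarify
    fix s assume s: "s \<in> S"
    let ?F = "{x \<in> S. f x = f s}"
    have F: "finite ?F" "?F \<noteq> {}" using S s by auto
    then have M: "Max ?F \<in> ?F" by (rule Max_in)
    have "Max ?F \<notin> X"
    proof
      assume "Max ?F \<in> X"
      then have "Max ?F + n \<in> ?F" using M X f by auto
      then show False using Max_ge[OF F(1)] n by fastforce
    qed
    then show "f s \<in> f ` (S - X)" using M by (metis (mono_tags, lifting) DiffI image_eqI mem_Collect_eq)
  qed
  then have "card (f ` S) \<le> card (S - X)"
    using S by (meson card_image_le card_mono finite_Diff finite_imageI order_trans)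
  also have "\<dots> = card S - card X" using X S by (simp add: card_Diff_subset finite_subset)
  finally show ?thesis using card_mono[OF S X(1)] by linarith
qed

text \<open>\<open>card_shift_ge\<close> is applied to \<open>S - T\<close>, which still contains
  \<open>X\<close> and its shift because \<open>T\<close> and \<open>X\<close> share no
  class.\<close>

lemma card_shift_ge_disjoint:
  fixes S T X :: "int set" and n :: int
  assumes S: "finite S" and n: "n > 0" and f: "\<And>x. f (x + n) = f x"
    and X: "X \<subseteq> S" "(\<lambda>x. x + n) ` X \<subseteq> S" and T: "T \<subseteq> S" "f ` T \<inter> f ` X = {}"
  shows "card T + card X + card (f ` S) \<le> card S + card (f ` T)"
proof -
  have fT: "finite T" using S T(1) finite_subset by blast
  have "card X + card (f ` (S - T)) \<le> card (S - T)"
  proof (rule card_shift_ge[where f = f, OF _ n f])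
    show "X \<subseteq> S - T" using X T by blast
    show "(\<lambda>x. x + n) ` X \<subseteq> S - T"
    proof clarify
      fix x assume "x \<in> X"
      moreover have "x + n \<notin> T"
      proof
        assume "x + n \<in> T"
        then have "f x \<in> f ` T" using f[of x] by (metis image_eqI)
        then show False using T(2) \<open>x \<in> X\<close> by blast
      qed
      ultimately show "x + n \<in> S - T" using X by blast
    qed
  qed (use S in simp)
  moreover have "card (S - T) = card S - card T" "card T \<le> card S"
    using S T fT by (auto simp: card_Diff_subset card_mono)
  moreover have "card (f ` S) \<le> card (f ` T) + card (f ` (S - T))"
  proof -
    have "f ` S = f ` T \<union> f ` (S - T)" using T by blast
    then show ?thesis by (metis card_Un_le)
  qed
  ultimately show ?thesis by linarith
qed

text \<open>By division with remainder, the least positive element of \<open>J\<close> divides every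
  element of \<open>A\<close>, hence \<open>Gcd A\<close>.\<close>

lemma int_subgroup_UNIV:
  fixes J :: "int set"
  assumes J: "add_subgroup J" and A: "A \<subseteq> J" "Gcd A = 1"
  shows "J = UNIV"
proof -
  have mult: "int n * x \<in> J" if "x \<in> J" for n x
    by (induction n) (use that J in \<open>auto simp: add_subgroup_zero add_subgroup_add algebra_simps\<close>)
  have mult': "k * x \<in> J" if "x \<in> J" for k x
  proof (cases "k \<ge> 0")
    case True then show ?thesis using mult[OF that, of "nat k"] by simp
  next
    case False then show ?thesis using add_subgroup_minus[OF J mult[OF that, of "nat (- k)"]] by simp
  qed
  have "\<exists>x\<in>A. x \<noteq> 0"
  proof (rule ccontr)
    assume "\<not> ?thesis"
    then have "Gcd A = 0" by auto
    then show False using A by simp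
  qed
  then obtain x where "x \<in> J" "x \<noteq> 0" using A by auto
  then have "nat \<bar>x\<bar> > 0 \<and> int (nat \<bar>x\<bar>) \<in> J"
    using add_subgroup_minus[OF J, of x] by (auto simp: abs_if)
  then have ex: "\<exists>n::nat. n > 0 \<and> int n \<in> J" by blast
  define d where "d = (LEAST n::nat. n > 0 \<and> int n \<in> J)"
  have d: "d > 0" "int d \<in> J" using LeastI_ex[OF ex] by (auto simp: d_def)
  have "int d dvd a" if "a \<in> A" for a
  proof -
    have "a - (a div int d) * int d \<in> J" using A that d mult' J by (intro add_subgroup_diff) auto
    then have m: "int (nat (a mod int d)) \<in> J" using d by (simp add: minus_div_mult_eq_mod)
    have "nat (a mod int d) < d" using d by (simp add: nat_less_iff)
    then have "\<not> (nat (a mod int d) > 0 \<and> int (nat (a mod int d)) \<in> J)"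
      using not_less_Least unfolding d_def by blast
    then have "nat (a mod int d) = 0" using m by (meson neq0_conv)
    moreover have "0 \<le> a mod int d" using d(1) by simp
    ultimately have "a mod int d = 0" by linarith
    then show ?thesis by auto
  qed
  then have "int d dvd Gcd A" by (rule Gcd_greatest)
  then have "d = 1" using A by simp
  then have "1 \<in> J" using d by simp
  then show ?thesis using mult'[of 1] by auto
qed

text \<open>Inclusion-exclusion for \<open>A\<close> and the coset \<open>a + H\<close>, both
  contained in \<open>A + H\<close>.\<close>

lemma card_add_coset:
  assumes "finite A" "add_subgroup H" "finite H" "a \<in> A"
  shows "card A + card H \<le> card (A + H) + card {x \<in> A. x - a \<in> H}"
proof -
  let ?C = "(\<lambda>h. a + h) ` H"
  have "A \<union> ?C \<subseteq> A + H"
  proof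
    fix x assume "x \<in> A \<union> ?C"
    then show "x \<in> A + H"
    proof
      assume "x \<in> A"
      then have "x + 0 \<in> A + H" using add_subgroup_zero[OF assms(2)] by (rule set_plus_intro)
      then show ?thesis by simp
    qed (use assms(4) in auto)
  qed
  then have "card (A \<union> ?C) \<le> card (A + H)" using assms by (intro card_mono finite_set_plus)
  moreover have "A \<inter> ?C = {x \<in> A. x - a \<in> H}" by (force simp: image_iff algebra_simps)
  moreover have "card ?C = card H" by (simp add: card_image)
  ultimately show ?thesis using card_Un_Int[of A ?C] assms by simp
qed

text \<open>Only the endpoints \<open>0\<close> and \<open>int n\<close> of the range coincide
  modulo \<open>n\<close>.\<close>

lemma card_le_card_circle_image:
  assumes n: "n > 0" and A: "A \<subseteq> {0..int n}"
  shows "card A \<le> card (circle_of n ` A) + 1"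
proof -
  have "inj_on (circle_of n) (A - {int n})"
  proof (rule inj_onI)
    fix x y assume a: "x \<in> A - {int n}" "y \<in> A - {int n}" "circle_of n x = circle_of n y"
    then have "0 \<le> x" "x < int n" "0 \<le> y" "y < int n" using A by force+
    then show "x = y" using a(3) by (simp add: circle_of_eq_iff[OF n])
  qed
  then have "card (A - {int n}) = card (circle_of n ` (A - {int n}))" by (simp add: card_image)
  also have "\<dots> \<le> card (circle_of n ` A)"
    using A by (intro card_mono image_mono) (auto intro: finite_subset)
  finally show ?thesis by (metis card_Diff1_le card_Diff_singleton_if le_diff_conv order_trans diff_le_self)
qed

text \<open>This is the diameter part of the 3k - 4 theorem for distinct summands. Let
  \<open>H\<close> be the stabilizer of the sumset modulo \<open>n\<close>. Either some coset of
  \<open>H\<close> in that sumset is free of residues of \<open>B\<close>, and the integers above it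
  are counted separately, or translation by \<open>A\<close> preserves \<open>B0 + H\<close>. In the
  second case \<open>Gcd A = 1\<close> forces every residue into the sumset.\<close>

theorem Lev_Smeliansky:
  fixes A B :: "int set"
  assumes n: "n > 0" and A: "A \<subseteq> {0..int n}" "0 \<in> A" "int n \<in> A" "Gcd A = 1"
    and B: "B \<subseteq> {0..int n}" "0 \<in> B"
  shows "card A + 2 * card B \<le> card (A + B) + 3 \<or> n + card B \<le> card (A + B)"
proof -
  define f where "f = circle_of n"
  define A0 B0 where "A0 = f ` A" and "B0 = f ` B"
  define H where "H = stabilizer (A0 + B0)"
  have fin: "finite A" "finite B" using A B by (auto intro: finite_subset)
  have fin0: "finite A0" "finite B0" "A0 \<noteq> {}" "B0 \<noteq> {}" using fin A B by (auto simp: A0_def B0_def)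
  have fadd: "f (x + y) = f x + f y" for x y by (simp add: f_def circle_of_add)
  have f0: "f 0 = 0" by (simp add: f_def circle_of_0)
  have fdiff: "f (x - y) = f x - f y" for x y
    using fadd[of "x - y" y] by (simp add: algebra_simps)
  have fn: "f (x + int n) = f x" for x by (simp add: f_def circle_of_eq_iff[OF n])
  have fS: "f ` (A + B) = A0 + B0"
    unfolding A0_def B0_def by (force simp: set_plus_def fadd)
  have H: "add_subgroup H" "finite H" unfolding H_def using add_subgroup_stabilizer
    finite_stabilizer[of "A0 + B0"] fin0 by (auto simp: finite_set_plus set_plus_def)
  have kn: "card (A0 + H) + card (B0 + H) \<le> card (A0 + B0) + card H"
    unfolding H_def by (rule Kneser[OF fin0])
  \<comment> \<open>Since \<open>0\<close> and \<open>n\<close> are in \<open>A\<close>, each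
    element of \<open>B\<close> occurs in \<open>A + B\<close> together with its shift by
    \<open>n\<close>, in the same residue class.\<close>
  have BS: "B \<subseteq> A + B" "(\<lambda>x. x + int n) ` B \<subseteq> A + B"
  proof -
    show "B \<subseteq> A + B" using A(2) by (auto simp: set_plus_def) (metis add_0)
    show "(\<lambda>x. x + int n) ` B \<subseteq> A + B" using A(3) by (auto simp: set_plus_def) (metis add.commute)
  qed
  show ?thesis
  proof (cases "\<exists>i\<in>A. \<exists>j\<in>B. f i + f j \<notin> B0 + H")
    case True
    then obtain i j where ij: "i \<in> A" "j \<in> B" "f i + f j \<notin> B0 + H" by auto
    \<comment> \<open>The sums of \<open>Ai\<close> and \<open>Bj\<close> all lie over one coset of
      \<open>H\<close>, whose residues avoid those of \<open>B\<close>, so they can be counted in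
      addition to the shifted copies of \<open>B\<close>.\<close>
    define Ai where "Ai = {a \<in> A. f a - f i \<in> H}"
    define Bj where "Bj = {b \<in> B. f b - f j \<in> H}"
    have fAB: "finite Ai" "finite Bj" "Ai \<noteq> {}" "Bj \<noteq> {}"
      using fin ij add_subgroup_zero[OF H(1)] by (auto simp: Ai_def Bj_def)
    have T: "f x - (f i + f j) \<in> H" if x: "x \<in> Ai + Bj" for x
    proof -
      from x obtain a b where ab: "a \<in> Ai" "b \<in> Bj" "x = a + b" by (rule set_plus_elim)
      then have "(f a - f i) + (f b - f j) \<in> H"
        using H(1) by (intro add_subgroup_add) (auto simp: Ai_def Bj_def)
      then show ?thesis using ab by (simp add: fadd algebra_simps)
    qed
    have "f ` (Ai + Bj) \<subseteq> (\<lambda>h. (f i + f j) + h) ` H"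
    proof clarify
      fix x assume "x \<in> Ai + Bj"
      from T[OF this] show "f x \<in> (\<lambda>h. (f i + f j) + h) ` H" by (force simp: image_iff algebra_simps)
    qed
    then have 1: "card (f ` (Ai + Bj)) \<le> card H"
      using H(2) by (meson card_image_le card_mono finite_imageI order_trans)
    have disj: "f ` (Ai + Bj) \<inter> f ` B = {}"
    proof (rule ccontr)
      assume "f ` (Ai + Bj) \<inter> f ` B \<noteq> {}"
      then obtain x b where xb: "x \<in> Ai + Bj" "b \<in> B" "f x = f b" by auto
      have "f b + - (f x - (f i + f j)) \<in> B0 + H"
        using xb(2) add_subgroup_minus[OF H(1) T[OF xb(1)]] by (intro set_plus_intro) (simp_all add: B0_def)
      then show False using ij xb by simp
    qed
    have "Ai + Bj \<subseteq> A + B" by (intro set_plus_mono2) (auto simp: Ai_def Bj_def)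
    from card_shift_ge_disjoint[where f = f, OF _ _ fn BS this disj] fin n
    have 2: "card (Ai + Bj) + card B + card (A0 + B0) \<le> card (A + B) + card (f ` (Ai + Bj))"
      by (simp add: fS finite_set_plus)
    have "{x \<in> A0. x - f i \<in> H} = f ` Ai" by (auto simp: A0_def Ai_def)
    moreover have "f i \<in> A0" using ij by (simp add: A0_def)
    ultimately have 3: "card A0 + card H \<le> card (A0 + H) + card Ai"
      using card_add_coset[OF fin0(1) H, of "f i"] card_image_le[OF fAB(1), of f] by simp
    have "{x \<in> B0. x - f j \<in> H} = f ` Bj" by (auto simp: B0_def Bj_def)
    moreover have "f j \<in> B0" using ij by (simp add: B0_def)
    ultimately have 4: "card B0 + card H \<le> card (B0 + H) + card Bj"
      using card_add_coset[OF fin0(2) H, of "f j"] card_image_le[OF fAB(2), of f] by simp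
    have "card A \<le> card A0 + 1" "card B \<le> card B0 + 1"
      using card_le_card_circle_image[OF n] A B by (auto simp: A0_def B0_def f_def)
    \<comment> \<open>The 3 in the claim is a loss of one in the integer bound for
      \<open>Ai + Bj\<close> and of one each for identifying \<open>0\<close> with \<open>n\<close>
      in \<open>A\<close> and in \<open>B\<close>.\<close>
    then show ?thesis using 1 2 3 4 kn card_sumset_ge[OF fAB] by linarith
  next
    case False
    define J where "J = {x. f x \<in> stabilizer (B0 + H)}"
    have fBH: "finite (B0 + H)" using fin0 H by (simp add: finite_set_plus)
    have J: "add_subgroup J"
      using add_subgroup_stabilizer[of "B0 + H"] unfolding J_def add_subgroup_def by (auto simp: f0 fdiff)
    have "A \<subseteq> J"
    proof
      fix a assume a: "a \<in> A"
      have "f a \<in> stabilizer (B0 + H)"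
      proof (rule mem_stabilizer_finite[OF fBH])
        fix x assume "x \<in> B0 + H"
        then obtain y h where "y \<in> B0" "h \<in> H" "x = y + h" by (rule set_plus_elim)
        then obtain b where b: "b \<in> B" "x = f b + h" "h \<in> H" by (auto simp: B0_def)
        have "f a + f b \<in> B0 + H" using False a b by auto
        then obtain y g where "y \<in> B0" "g \<in> H" "f a + f b = y + g" by (rule set_plus_elim)
        then have "x + f a = y + (g + h)" "y \<in> B0" "g + h \<in> H"
          using b add_subgroup_add[OF H(1)] by (auto simp: algebra_simps)
        then show "x + f a \<in> B0 + H" by (metis set_plus_intro)
      qed
      then show "a \<in> J" by (simp add: J_def)
    qed
    then have JU: "J = UNIV" using int_subgroup_UNIV[OF J] A(4) by blast
    have "f x \<in> A0 + B0" for x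
    proof -
      have z: "0 \<in> A0" "0 \<in> B0" using A(2) B(2) f0 by (auto simp: A0_def B0_def image_iff intro!: bexI[of _ 0])
      have "0 + 0 \<in> B0 + H" using z(2) add_subgroup_zero[OF H(1)] by (rule set_plus_intro)
      moreover have "f x \<in> stabilizer (B0 + H)" using JU by (auto simp: J_def)
      then have "0 + f x \<in> B0 + H \<longleftrightarrow> 0 \<in> B0 + H" unfolding stabilizer_def by blast
      ultimately have "f x \<in> B0 + H" by simp
      then obtain y h where yh: "y \<in> B0" "h \<in> H" "f x = y + h" by (rule set_plus_elim)
      have "0 + y \<in> A0 + B0" using z(1) yh(1) by (rule set_plus_intro)
      then show ?thesis using yh periodic_stabilizer[of "A0 + B0"] by (simp add: H_def periodic_def)
    qed
    then have "f ` {0..<int n} \<subseteq> f ` (A + B)" by (auto simp: fS)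
    then have "card (f ` {0..<int n}) \<le> card (f ` (A + B))"
      using fin by (intro card_mono finite_imageI finite_set_plus)
    moreover have "inj_on f {0..<int n}"
      by (intro inj_onI) (simp add: f_def circle_of_eq_iff[OF n])
    ultimately have "n \<le> card (f ` (A + B))" by (simp add: card_image)
    then show ?thesis using card_shift_ge[where f = f, OF _ _ fn BS] fin n by (simp add: finite_set_plus)
  qed
qed

section \<open>Long intervals in dense integer sumsets\<close>

text \<open>The part of \<open>A\<close> in \<open>{p..q}\<close> and the part of the reflection of
  \<open>B\<close> under \<open>b \<mapsto> z - b\<close> in \<open>{p..q}\<close> are
  disjoint.\<close>

lemma sumset_pigeonhole:
  fixes A B :: "int set"
  assumes "z \<notin> A + B" "p \<le> q + 1"
  shows "int (card (A \<inter> {p..q})) + int (card (B \<inter> {z - q..z - p})) \<le> q - p + 1"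
proof -
  let ?R = "(\<lambda>b. z - b) ` (B \<inter> {z - q..z - p})"
  have "(A \<inter> {p..q}) \<inter> ?R = {}"
  proof (rule ccontr)
    assume "\<not> ?thesis"
    then obtain b where "b \<in> B" "z - b \<in> A" by auto
    then have "(z - b) + b \<in> A + B" by (intro set_plus_intro)
    then show False using assms(1) by simp
  qed
  moreover have "card ?R = card (B \<inter> {z - q..z - p})" by (simp add: card_image inj_on_def)
  moreover have "card ((A \<inter> {p..q}) \<union> ?R) \<le> card {p..q}" by (intro card_mono) auto
  ultimately have "card (A \<inter> {p..q}) + card (B \<inter> {z - q..z - p}) \<le> card {p..q}"
    by (simp add: card_Un_disjoint)
  then show ?thesis using assms(2) by simp
qed

lemma card_le_Int_intervals:
  fixes A :: "int set"
  assumes "A \<subseteq> {u..v}"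
  shows "int (card A) \<le> int (card (A \<inter> {u..x})) + int (card (A \<inter> {y..v})) + max 0 (y - x - 1)"
proof -
  have "A \<subseteq> (A \<inter> {u..x}) \<union> (A \<inter> {y..v}) \<union> {x + 1..y - 1}" using assms by auto
  then have "card A \<le> card ((A \<inter> {u..x}) \<union> (A \<inter> {y..v}) \<union> {x + 1..y - 1})" by (intro card_mono) auto
  also have "\<dots> \<le> card (A \<inter> {u..x}) + card (A \<inter> {y..v}) + card {x + 1..y - 1}"
    by (meson add_right_mono card_Un_le order_trans)
  finally show ?thesis by simp
qed

text \<open>If \<^term>\<open>x\<close> and \<^term>\<open>l + y\<close> are missing from \<^term>\<open>A + B\<close> and \<^term>\<open>y < x\<close> are as
  close as possible, then the integers strictly between them and \<^term>\<open>B\<close> occur in \<^term>\<open>A + B\<close>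
  both as they are and shifted by \<^term>\<open>l\<close>, which makes \<^term>\<open>A + B\<close> too large. So the last
  missing element on the left and the first one on the right enclose an interval.\<close>

lemma long_interval:
  fixes A B :: "int set" and l m :: int
  assumes A: "A \<subseteq> {0..l}" "0 \<in> A" "l \<in> A" and B: "B \<subseteq> {0..m}" "0 \<in> B" "m \<in> B"
    and ml: "m \<le> l" "l > 0"
    and dense: "l + 4 \<le> int (card A) + int (card B)"
    and small: "card (A + B) + 4 \<le> card A + 2 * card B"
  shows "\<exists>u. {u..u + int (card A) + int (card B) - 2} \<subseteq> A + B"
proof -
  have fin: "finite A" "finite B" using A B by (auto intro: finite_subset)
  have m0: "0 \<le> m" using B by auto
  define S where "S = A + B"
  have fS: "finite S" using fin by (simp add: S_def finite_set_plus)
  have S: "S \<subseteq> {0..l + m}" using A(1) B(1) by (force simp: S_def set_plus_def)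
  have BS: "B \<subseteq> S" "(\<lambda>x. x + l) ` B \<subseteq> S"
  proof -
    show "B \<subseteq> S" using A(2) by (auto simp: S_def set_plus_def) (metis add_0)
    show "(\<lambda>x. x + l) ` B \<subseteq> S" using A(3) by (auto simp: S_def set_plus_def) (metis add.commute)
  qed
  \<comment> \<open>For such \<open>z\<close> all of \<open>B\<close> is reflected into
    \<open>{z - m..z}\<close>. A missing \<open>z\<close> would leave room for \<open>m + 1\<close>
    elements there and for \<open>l - m\<close> elements of \<open>A\<close> outside, too few for
    \<open>dense\<close>.\<close>
  have mid: "z \<in> S" if "m \<le> z" "z \<le> l" for z
  proof (rule ccontr)
    assume "z \<notin> S"
    from sumset_pigeonhole[OF this[unfolded S_def], of "z - m" z]
    have "int (card (A \<inter> {z - m..z})) + int (card (B \<inter> {0..m})) \<le> m + 1" using m0 by simp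
    moreover have "B \<inter> {0..m} = B" using B by auto
    moreover have "card A \<le> card ((A \<inter> {z - m..z}) \<union> ({0..z - m - 1} \<union> {z + 1..l}))"
      using A(1) by (intro card_mono) (auto intro: finite_subset)
    moreover have "card ((A \<inter> {z - m..z}) \<union> ({0..z - m - 1} \<union> {z + 1..l}))
        \<le> card (A \<inter> {z - m..z}) + (card {0..z - m - 1} + card {z + 1..l})"
      by (meson add_left_mono card_Un_le order_trans)
    ultimately show False using dense that m0 by simp
  qed
  \<comment> \<open>The pigeonhole bounds for \<open>z\<close> on \<open>{0..z}\<close> and for
    \<open>z + l\<close> on \<open>{z..l}\<close> would together give a total of at most
    \<open>l + 2\<close>.\<close>
  have full: "z \<in> S \<or> z + l \<in> S" if "0 \<le> z" "z \<le> l" for z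
  proof (rule ccontr)
    assume "\<not> ?thesis"
    then have n: "z \<notin> A + B" "z + l \<notin> A + B" by (auto simp: S_def)
    from sumset_pigeonhole[OF n(1), of 0 z] sumset_pigeonhole[OF n(2), of z l] that
    have "int (card (A \<inter> {0..z})) + int (card (B \<inter> {0..z})) \<le> z + 1"
      "int (card (A \<inter> {z..l})) + int (card (B \<inter> {z..l})) \<le> l - z + 1" by simp_all
    moreover have "B \<subseteq> {0..l}" using B ml by auto
    ultimately show False
      using card_le_Int_intervals[OF A(1), of z z] card_le_Int_intervals[of B 0 l z z] that dense by simp
  qed
  \<comment> \<open>The values \<open>- 1\<close> and \<open>m + 1\<close> represent points just
    outside the range of the sumset, so that neither \<open>X\<close> nor \<open>Y\<close> is
    empty.\<close>
  define X where "X = {z \<in> {-1..m}. z \<notin> S}"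
  define Y where "Y = {z \<in> {0..m + 1}. l + z \<notin> S}"
  have "X \<subseteq> {-1..m}" "Y \<subseteq> {0..m + 1}" by (auto simp: X_def Y_def)
  then have fXY: "finite X" "finite Y" by (auto intro: finite_subset)
  have "- 1 \<in> X" "m + 1 \<in> Y" using S m0 by (auto simp: X_def Y_def)
  have Xn: "int (card (A \<inter> {0..x})) + int (card (B \<inter> {0..x})) \<le> x + 1" if "x \<in> X" for x
    using sumset_pigeonhole[of x A B 0 x] that by (simp add: X_def S_def)
  have Yn: "int (card (A \<inter> {l + y - m..l})) + int (card (B \<inter> {y..m})) \<le> m - y + 1" if "y \<in> Y" for y
    using sumset_pigeonhole[of "l + y" A B "l + y - m" l] that by (simp add: Y_def S_def)
  have XY: "x < y" if "x \<in> X" "y \<in> Y" for x y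
  proof (rule ccontr)
    assume "\<not> x < y"
    then have "nat (x - y) = nat (x - y) \<and> y \<le> x \<and> x \<in> X \<and> y \<in> Y" using that by simp
    then have ex: "\<exists>d. \<exists>x y. d = nat (x - y) \<and> y \<le> x \<and> x \<in> X \<and> y \<in> Y" by blast
    define d where "d = (LEAST d. \<exists>x y. d = nat (x - y) \<and> y \<le> x \<and> x \<in> X \<and> y \<in> Y)"
    obtain x y where xy: "d = nat (x - y)" "y \<le> x" "x \<in> X" "y \<in> Y"
      using LeastI_ex[OF ex] unfolding d_def by blast
    have least: "d \<le> nat (x' - y')" if "y' \<le> x'" "x' \<in> X" "y' \<in> Y" for x' y'
      unfolding d_def by (rule Least_le) (use that in blast)
    have r: "0 \<le> y" "x \<le> m" "x \<le> l" using xy ml by (auto simp: X_def Y_def)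
    have "x \<noteq> y" using full[of x] xy r by (auto simp: X_def Y_def add.commute)
    then have lt: "y < x" using xy by simp
    let ?I = "{y + 1..x - 1}"
    have I: "?I \<subseteq> S"
    proof
      fix z assume z: "z \<in> ?I"
      then have "\<not> d \<le> nat (z - y)" using xy(1) by auto
      then have "z \<notin> X" using least[of y z] xy z by auto
      then show "z \<in> S" using z r by (auto simp: X_def)
    qed
    have I': "(\<lambda>z. z + l) ` ?I \<subseteq> S"
    proof clarify
      fix z assume z: "z \<in> ?I"
      then have "\<not> d \<le> nat (x - z)" using xy(1) by auto
      then have "z \<notin> Y" using least[of z x] xy z by auto
      then show "z + l \<in> S" using z r by (auto simp: Y_def add.commute)
    qed
    \<comment> \<open>The shift bound modulo \<open>l\<close>: by \<open>full\<close>, all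
      \<open>l\<close> residue classes occur in \<open>S\<close>.\<close>
    have "card (B \<union> ?I) + card ((\<lambda>z. z mod l) ` S) \<le> card S"
      using I I' BS ml by (intro card_shift_ge[where n = l] fS) (auto simp: image_Un)
    moreover have "{0..<l} \<subseteq> (\<lambda>z. z mod l) ` S"
    proof
      fix z assume z: "z \<in> {0..<l}"
      then have e: "z mod l = z" "(z + l) mod l = z" by simp_all
      have "z \<in> S \<or> z + l \<in> S" using full[of z] z by simp
      then show "z \<in> (\<lambda>z. z mod l) ` S"
      proof
        assume "z \<in> S"
        then have "z mod l \<in> (\<lambda>z. z mod l) ` S" by (rule imageI)
        then show ?thesis unfolding e .
      next
        assume "z + l \<in> S"
        then have "(z + l) mod l \<in> (\<lambda>z. z mod l) ` S" by (rule imageI)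
        then show ?thesis unfolding e .
      qed
    qed
    then have "card {0..<l} \<le> card ((\<lambda>z. z mod l) ` S)" using fS by (intro card_mono) auto
    moreover have "card (B \<union> ?I) + card (B \<inter> ?I) = card B + card ?I"
      using fin card_Un_Int[of B ?I] by simp
    moreover have "card (B \<inter> ?I) \<le> card (B \<inter> {y..x})" using fin by (intro card_mono) auto
    ultimately have 1: "l + int (card B) + (x - y - 1) \<le> int (card S) + int (card (B \<inter> {y..x}))"
      using lt ml by simp
    have "B \<inter> {0..x} \<union> B \<inter> {y..m} = B" "(B \<inter> {0..x}) \<inter> (B \<inter> {y..m}) = B \<inter> {y..x}"
      using B(1) lt r by auto
    then have 2: "card (B \<inter> {0..x}) + card (B \<inter> {y..m}) = card B + card (B \<inter> {y..x})"
      using card_Un_Int[of "B \<inter> {0..x}" "B \<inter> {y..m}"] fin by simp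
    \<comment> \<open>The pigeonhole bounds left of \<open>x\<close> and right of
      \<open>l + y\<close> are added. The part of \<open>B\<close> between \<open>y\<close> and
      \<open>x\<close> is counted twice, and the \<open>max\<close> term covers the elements of
      \<open>A\<close> that may lie between the two intervals.\<close>
    have 3: "int (card A) + int (card B) + int (card (B \<inter> {y..x})) \<le> x - y + m + 2 + max 0 (l + y - m - x - 1)"
      using Xn[OF xy(3)] Yn[OF xy(4)] 2 card_le_Int_intervals[OF A(1), of x "l + y - m"] ml by linarith
    show False
    proof (cases "l + y - m - x - 1 \<ge> 0")
      case True
      then show ?thesis using 3 dense by simp
    next
      case False
      then have "int (card A) + int (card B) + int (card (B \<inter> {y..x})) \<le> x - y + m + 2" using 3 by simp
      then show ?thesis using 1 small ml unfolding S_def by linarith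
    qed
  qed
  define x where "x = Max X"
  define y where "y = Min Y"
  have x: "x \<in> X" "\<And>z. z \<in> X \<Longrightarrow> z \<le> x" using fXY \<open>- 1 \<in> X\<close> by (auto simp: x_def intro: Max_in)
  have y: "y \<in> Y" "\<And>z. z \<in> Y \<Longrightarrow> y \<le> z" using fXY \<open>m + 1 \<in> Y\<close> by (auto simp: y_def intro: Min_in)
  have xy: "x < y" by (rule XY[OF x(1) y(1)])
  have "{x + 1..l + y - 1} \<subseteq> S"
  proof
    fix z assume z: "z \<in> {x + 1..l + y - 1}"
    have "-1 \<le> x" using x \<open>- 1 \<in> X\<close> by auto
    have "y \<le> m + 1" using y \<open>m + 1 \<in> Y\<close> by auto
    consider "z < m" | "m \<le> z" "z \<le> l" | "l < z" by linarith
    then show "z \<in> S"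
    proof cases
      case 1
      then show ?thesis using z x(2)[of z] \<open>-1 \<le> x\<close> by (force simp: X_def)
    next
      case 3
      then show ?thesis using z y(2)[of "z - l"] \<open>y \<le> m + 1\<close> by (force simp: Y_def)
    qed (rule mid)
  qed
  \<comment> \<open>As \<open>{x + 1..l + y - 1}\<close> has \<open>l + y - x - 1\<close> elements,
    this gives it length at least \<open>card A + card B - 1\<close>.\<close>
  moreover have "int (card A) + int (card B) \<le> l + y - x"
    using Xn[OF x(1)] Yn[OF y(1)] xy card_le_Int_intervals[OF A(1), of x "l + y - m"]
      card_le_Int_intervals[OF B(1), of x y] ml m0 by linarith
  ultimately have "{x + 1..(x + 1) + int (card A) + int (card B) - 2} \<subseteq> A + B" unfolding S_def by force
  then show ?thesis by blast
qed

text \<open>Otherwise \<open>B\<close> splits into nonempty sets of multiples and non-multiples of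
  \<open>Gcd A\<close>. Their sumsets with \<open>A\<close> are disjoint, and the bounds from
  \<open>card_sumset_ge\<close> add up to \<open>2 * card A + card B - 2\<close>.\<close>

lemma Gcd_eq_1_of_small_sumset:
  fixes A B :: "int set"
  assumes fin: "finite A" "finite B" and 0: "0 \<in> A" "0 \<in> B" and g: "Gcd (A \<union> B) = 1"
    and small: "card (A + B) + 3 \<le> 2 * card A + card B"
  shows "Gcd A = 1"
proof (rule ccontr)
  assume ne: "Gcd A \<noteq> 1"
  define d where "d = Gcd A"
  have dA: "d dvd a" if "a \<in> A" for a using that by (simp add: d_def)
  define B0 B1 where "B0 = {b \<in> B. d dvd b}" and "B1 = {b \<in> B. \<not> d dvd b}"
  have "B1 \<noteq> {}"
  proof
    assume "B1 = {}"
    then have "d dvd x" if "x \<in> A \<union> B" for x using that dA by (auto simp: B1_def)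
    then have "d dvd 1" using Gcd_greatest[of "A \<union> B" d] g by simp
    then show False using ne by (simp add: d_def)
  qed
  moreover have "B0 \<noteq> {}" using 0 unfolding B0_def by force
  moreover have fB: "finite B0" "finite B1" using fin by (auto simp: B0_def B1_def)
  ultimately have 1: "card A + card B0 \<le> card (A + B0) + 1" "card A + card B1 \<le> card (A + B1) + 1"
    using fin 0(1) card_sumset_ge[of A B0] card_sumset_ge[of A B1] by blast+
  have "B = B0 \<union> B1" "B0 \<inter> B1 = {}" by (auto simp: B0_def B1_def)
  then have 2: "card B = card B0 + card B1" using fB by (simp add: card_Un_disjoint)
  have "(A + B0) \<inter> (A + B1) = {}"
  proof (rule ccontr)
    assume "\<not> ?thesis"
    then obtain x where x: "x \<in> A + B0" "x \<in> A + B1" by auto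
    from x(1) obtain a b where "a \<in> A" "b \<in> B0" "x = a + b" by (rule set_plus_elim)
    then have "d dvd x" using dA by (auto simp: B0_def)
    from x(2) obtain a' b' where "a' \<in> A" "b' \<in> B1" "x = a' + b'" by (rule set_plus_elim)
    then show False using dA \<open>d dvd x\<close> by (auto simp: B1_def dvd_add_right_iff)
  qed
  then have "card (A + B0) + card (A + B1) = card ((A + B0) \<union> (A + B1))"
    using fin fB by (simp add: card_Un_disjoint finite_set_plus)
  also have "\<dots> \<le> card (A + B)"
    using fin by (intro card_mono finite_set_plus Un_least set_plus_mono2) (auto simp: B0_def B1_def)
  finally show False using 1 2 small by linarith
qed

text \<open>The bound on the smaller diameter \<^term>\<open>m\<close> follows from the interval, which meets all residue
  classes modulo \<^term>\<open>m\<close>.\<close>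

lemma sumset_structure_aux:
  fixes A B :: "int set" and l m :: int
  assumes A: "A \<subseteq> {0..l}" "0 \<in> A" "l \<in> A" and B: "B \<subseteq> {0..m}" "0 \<in> B" "m \<in> B"
    and ml: "m \<le> l" and g: "Gcd (A \<union> B) = 1"
    and small: "card (A + B) + 4 \<le> card A + card B + min (card A) (card B)"
  shows "(\<exists>u. {u..u + int (card A) + int (card B) - 2} \<subseteq> A + B) \<and>
    l + int (card B) \<le> int (card (A + B)) \<and> m + int (card A) \<le> int (card (A + B))"
proof -
  have fin: "finite A" "finite B" using A B by (auto intro: finite_subset)
  have gA: "Gcd A = 1" using Gcd_eq_1_of_small_sumset[OF fin A(2) B(2) g] small by linarith
  have "0 \<le> l" "0 \<le> m" using A B by auto
  have "l \<noteq> 0"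
  proof
    assume "l = 0"
    then have "A = {0}" using A by auto
    then show False using gA by simp
  qed
  then have l: "l > 0" using \<open>0 \<le> l\<close> by simp
  have "B \<subseteq> {0..l}" using B ml by auto
  \<comment> \<open>The other alternative of \<open>Lev_Smeliansky\<close> is excluded by
    \<open>small\<close>.\<close>
  from Lev_Smeliansky[of "nat l" A B] A B this gA l small
  have 1: "l + int (card B) \<le> int (card (A + B))" by auto
  then have dense: "l + 4 \<le> int (card A) + int (card B)" using small by linarith
  have sm: "card (A + B) + 4 \<le> card A + 2 * card B" using small by linarith
  from long_interval[OF A B ml l dense sm]
  obtain u where u: "{u..u + int (card A) + int (card B) - 2} \<subseteq> A + B" ..
  have 2: "m + int (card A) \<le> int (card (A + B))"
  proof (cases "m = 0")
    case True
    have "A \<subseteq> A + B" using B(2) by (auto simp: set_plus_def) (metis add_0_right)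
    then show ?thesis using True fin by (simp add: card_mono finite_set_plus)
  next
    case False
    then have m: "m > 0" using \<open>0 \<le> m\<close> by simp
    have "A \<subseteq> A + B" using B(2) by (auto simp: set_plus_def) (metis add_0_right)
    moreover have "(\<lambda>x. x + m) ` A \<subseteq> A + B" using B(3) by auto
    ultimately have "card A + card ((\<lambda>z. z mod m) ` (A + B)) \<le> card (A + B)"
      using fin m by (intro card_shift_ge[where n = m]) (auto simp: finite_set_plus)
    moreover have "{0..<m} \<subseteq> (\<lambda>z. z mod m) ` (A + B)"
    proof
      fix z assume z: "z \<in> {0..<m}"
      \<comment> \<open>This is the representative of \<open>z\<close> among the first
        \<open>m\<close> integers from \<open>u\<close>; by \<open>dense\<close> the interval is
        longer than \<open>m\<close>.\<close>
      have "u + (z - u) mod m \<in> A + B" using u m dense ml pos_mod_bound[OF m, of "z - u"] pos_mod_sign[OF m, of "z - u"]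
        by (intro subsetD[OF u]) auto
      moreover have "(u + (z - u) mod m) mod m = z" using z by (simp add: mod_add_right_eq)
      ultimately show "z \<in> (\<lambda>z. z mod m) ` (A + B)" by (metis imageI)
    qed
    then have "card {0..<m} \<le> card ((\<lambda>z. z mod m) ` (A + B))"
      using fin by (intro card_mono finite_imageI finite_set_plus)
    ultimately show ?thesis using m by simp
  qed
  show ?thesis using u 1 2 by blast
qed

text \<open>By symmetry the set of larger diameter may come first. The gcd conclusions serve the
  next lifting pass, in which one of the two sets is kept and the other is replaced.\<close>

theorem sumset_structure:
  fixes A B :: "int set" and l m :: int
  assumes A: "A \<subseteq> {0..l}" "0 \<in> A" "l \<in> A" and B: "B \<subseteq> {0..m}" "0 \<in> B" "m \<in> B"
    and g: "Gcd (A \<union> B) = 1"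
    and small: "card (A + B) + 4 \<le> card A + card B + min (card A) (card B)"
  shows "\<exists>u. {u..u + int (card A) + int (card B) - 2} \<subseteq> A + B"
    and "l + int (card B) \<le> int (card (A + B))" and "m + int (card A) \<le> int (card (A + B))"
    and "Gcd A = 1" and "Gcd B = 1"
proof -
  have fin: "finite A" "finite B" using A B by (auto intro: finite_subset)
  have small': "card (B + A) + 4 \<le> card B + card A + min (card B) (card A)"
    using small by (simp add: add.commute min.commute)
  have g': "Gcd (B \<union> A) = 1" using g by (simp add: Un_commute)
  show "Gcd A = 1" using Gcd_eq_1_of_small_sumset[OF fin A(2) B(2) g] small by linarith
  show "Gcd B = 1" using Gcd_eq_1_of_small_sumset[OF fin(2,1) B(2) A(2) g'] small' by linarith
  have "(\<exists>u. {u..u + int (card A) + int (card B) - 2} \<subseteq> A + B) \<and>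
    l + int (card B) \<le> int (card (A + B)) \<and> m + int (card A) \<le> int (card (A + B))"
  proof (cases "m \<le> l")
    case True
    then show ?thesis by (rule sumset_structure_aux[OF A B _ g small])
  next
    case False
    then have "l \<le> m" by simp
    from sumset_structure_aux[OF B A this g' small'] show ?thesis
      by (simp add: add.commute add.left_commute)
  qed
  then show "\<exists>u. {u..u + int (card A) + int (card B) - 2} \<subseteq> A + B"
    "l + int (card B) \<le> int (card (A + B))" "m + int (card A) \<le> int (card (A + B))" by auto
qed

section \<open>Rectification modulo a prime\<close>

lemma of_int_mod_ring_eq_iff:
  "(of_int m :: 'p::nontriv mod_ring) = of_int n \<longleftrightarrow> m mod int CARD('p) = n mod int CARD('p)"
  by transfer simp

lemma of_int_to_int_mod_ring [simp]: "of_int (to_int_mod_ring x) = (x :: 'p::nontriv mod_ring)"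
  by (simp add: of_int_of_int_mod_ring)

lemma inj_on_of_int_mod_ring:
  assumes "v < u + int CARD('p)"
  shows "inj_on (of_int :: int \<Rightarrow> 'p::nontriv mod_ring) {u..v}"
proof (rule inj_onI)
  fix m n :: int
  assume mn: "m \<in> {u..v}" "n \<in> {u..v}" and "(of_int m :: 'p mod_ring) = of_int n"
  then have "int CARD('p) dvd m - n" by (simp add: of_int_mod_ring_eq_iff mod_eq_dvd_iff)
  moreover have "\<bar>m - n\<bar> < int CARD('p)" using mn assms by auto
  ultimately show "m = n" using dvd_imp_le_int[of "m - n" "int CARD('p)"] by (cases "m = n") auto
qed

lemma ex_int_representative:
  "\<exists>n\<in>{w..w + int CARD('p) - 1}. of_int n = (x :: 'p::nontriv mod_ring)"
proof
  define p where "p = int CARD('p)"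
  have p: "p > 0" by (simp add: p_def)
  let ?n = "w + (to_int_mod_ring x - w) mod p"
  show "?n \<in> {w..w + int CARD('p) - 1}"
    using pos_mod_bound[OF p] pos_mod_sign[OF p] unfolding p_def[symmetric] by (auto intro: zle_diff1_eq[THEN iffD2] simp: add.commute)
  have "?n mod p = to_int_mod_ring x mod p" by (simp add: mod_add_right_eq)
  then have "of_int ?n = (of_int (to_int_mod_ring x) :: 'p mod_ring)"
    by (simp only: of_int_mod_ring_eq_iff p_def)
  then show "of_int ?n = x" by simp
qed

text \<open>With \<open>p\<close> the modulus, representatives are taken in
  \<open>{1 - u - p..- u}\<close>, whose negatives form \<open>{u..u + p - 1}\<close>. The avoided
  interval starts at the same \<open>u\<close>, so every representative is at most
  \<open>- u - N\<close>.\<close>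

lemma lift_avoiding_interval:
  fixes X :: "'p::nontriv mod_ring set"
  assumes X: "X \<noteq> {}" and avoid: "\<And>x. x \<in> X \<Longrightarrow> - x \<notin> of_int ` {u..u + N - 1}"
  shows "\<exists>\<beta> h X'. X' \<subseteq> {0..h} \<and> 0 \<in> X' \<and> h \<in> X' \<and> h + N < int CARD('p) \<and>
    of_int ` X' = (\<lambda>x. x - \<beta>) ` X \<and> card X' = card X"
proof -
  define p where "p = int CARD('p)"
  define Y where "Y = {n \<in> {1 - u - p..- u}. of_int n \<in> X}"
  have "Y \<subseteq> {1 - u - p..- u}" by (auto simp: Y_def)
  then have fY: "finite Y" by (rule finite_subset) simp
  have YX: "of_int ` Y = X"
  proof
    show "X \<subseteq> of_int ` Y"
    proof
      fix x assume "x \<in> X"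
      moreover obtain n where "n \<in> {1 - u - p..1 - u - p + int CARD('p) - 1}" "of_int n = x"
        using ex_int_representative[of "1 - u - p" x] by blast
      ultimately show "x \<in> of_int ` Y" by (auto simp: Y_def p_def)
    qed
  qed (auto simp: Y_def)
  have Yne: "Y \<noteq> {}" using YX X by auto
  have Yup: "n \<le> - u - N" if "n \<in> Y" for n
  proof -
    have "of_int (- n) \<notin> (of_int ` {u..u + N - 1} :: 'p mod_ring set)" using avoid that by (simp add: Y_def)
    then have "- n \<notin> {u..u + N - 1}" by blast
    then show ?thesis using that by (auto simp: Y_def)
  qed
  let ?m = "Min Y" and ?X' = "(\<lambda>n. n - Min Y) ` Y"
  have m: "?m \<in> Y" "Max Y \<in> Y" using fY Yne by auto
  have "inj_on (of_int :: int \<Rightarrow> 'p mod_ring) {1 - u - p..- u}"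
    by (rule inj_on_of_int_mod_ring) (simp add: p_def)
  then have "inj_on (of_int :: int \<Rightarrow> 'p mod_ring) Y" using \<open>Y \<subseteq> _\<close> by (rule inj_on_subset)
  then have "card (of_int ` Y :: 'p mod_ring set) = card Y" by (rule card_image)
  then have "card Y = card X" unfolding YX by simp
  then have "card ?X' = card X" by (simp add: card_image inj_on_def)
  moreover have "?X' \<subseteq> {0..Max Y - ?m}" using fY by auto
  moreover have "0 \<in> ?X'" "Max Y - ?m \<in> ?X'" using m by auto
  moreover have "Max Y - ?m + N < int CARD('p)" using Yup[OF m(2)] m(1) by (auto simp: Y_def p_def)
  moreover have "of_int ` ?X' = (\<lambda>x. x - of_int ?m) ` X" unfolding YX[symmetric] by (auto simp: image_image)
  ultimately show ?thesis by blast
qed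

text \<open>The sumset of the lifted sets contains a long interval, and the third set avoids its negative.\<close>

lemma rectification_step:
  fixes A B C :: "'p::nontriv mod_ring set" and A' B' :: "int set"
  assumes A: "A' \<subseteq> {0..l}" "0 \<in> A'" "l \<in> A'" "of_int ` A' \<subseteq> (\<lambda>x. x - \<alpha>) ` A"
    and B: "B' \<subseteq> {0..m}" "0 \<in> B'" "m \<in> B'" "of_int ` B' \<subseteq> (\<lambda>x. x - \<beta>) ` B"
    and lm: "l + m < int CARD('p)" and g: "Gcd (A' \<union> B') = 1"
    and small: "card (A + B) + 4 \<le> card A' + card B' + min (card A') (card B')"
    and C: "C \<noteq> {}" "\<And>x. x \<in> C \<Longrightarrow> - x \<notin> A + B"
  shows "l + int (card B') \<le> card (A + B)" "m + int (card A') \<le> card (A + B)" "Gcd A' = 1" "Gcd B' = 1"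
    "\<exists>\<gamma> h C'. C' \<subseteq> {0..h} \<and> 0 \<in> C' \<and> h \<in> C' \<and> h + int (card A') + int (card B') \<le> int CARD('p) \<and>
      of_int ` C' = (\<lambda>x. x - \<gamma>) ` C \<and> card C' = card C"
proof -
  have sub: "of_int ` (A' + B') \<subseteq> (\<lambda>x. x - (\<alpha> + \<beta>)) ` (A + B)"
  proof
    fix x :: "'p mod_ring" assume "x \<in> of_int ` (A' + B')"
    then obtain a b where ab: "a \<in> A'" "b \<in> B'" "x = of_int a + of_int b" by (auto simp: set_plus_def)
    then have "x \<in> (\<lambda>x. x - \<alpha>) ` A + (\<lambda>x. x - \<beta>) ` B" using A(4) B(4) by blast
    then show "x \<in> (\<lambda>x. x - (\<alpha> + \<beta>)) ` (A + B)" by (simp only: set_plus_translate)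
  qed
  \<comment> \<open>The bound \<open>lm\<close> excludes wraparound, so the integer sumset is no
    larger than the sumset of residues.\<close>
  have "A' + B' \<subseteq> {0..l + m}" using A(1) B(1) by (force simp: set_plus_def)
  moreover have "inj_on (of_int :: int \<Rightarrow> 'p mod_ring) {0..l + m}"
    by (rule inj_on_of_int_mod_ring) (use lm in simp)
  ultimately have "inj_on (of_int :: int \<Rightarrow> 'p mod_ring) (A' + B')" by (meson inj_on_subset)
  then have "card (A' + B') = card (of_int ` (A' + B') :: 'p mod_ring set)" by (simp add: card_image)
  also have "\<dots> \<le> card ((\<lambda>x. x - (\<alpha> + \<beta>)) ` (A + B))" using sub by (intro card_mono) auto
  also have "\<dots> = card (A + B)" by (simp add: card_image inj_on_def)
  finally have le: "card (A' + B') \<le> card (A + B)" .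
  then have small': "card (A' + B') + 4 \<le> card A' + card B' + min (card A') (card B')" using small by linarith
  note str = sumset_structure[OF A(1-3) B(1-3) g small']
  show "l + int (card B') \<le> card (A + B)" "m + int (card A') \<le> card (A + B)" using str(2,3) le by linarith+
  show "Gcd A' = 1" "Gcd B' = 1" by (rule str(4), rule str(5))
  from str(1) obtain u where u: "{u..u + int (card A') + int (card B') - 2} \<subseteq> A' + B'" ..
  \<comment> \<open>The lifts are translated by \<open>- \<alpha>\<close> and
    \<open>- \<beta>\<close>; the opposite translation of \<open>C\<close> keeps the sums of the
    three sets away from 0.\<close>
  let ?D = "(\<lambda>x. x + (\<alpha> + \<beta>)) ` C"
  have avoid: "- y \<notin> of_int ` {u..u + (int (card A') + int (card B') - 1) - 1}" if y: "y \<in> ?D" for y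
  proof
    assume "- y \<in> of_int ` {u..u + (int (card A') + int (card B') - 1) - 1}"
    then have "- y \<in> (\<lambda>x. x - (\<alpha> + \<beta>)) ` (A + B)" using u sub by (auto simp: algebra_simps)
    moreover obtain x where x: "x \<in> C" "y = x + (\<alpha> + \<beta>)" using y by auto
    ultimately have "- x \<in> A + B" by auto
    then show False using C(2)[OF x(1)] by simp
  qed
  have "?D \<noteq> {}" using C(1) by simp
  from lift_avoiding_interval[OF this avoid] obtain \<gamma> h C' where
    C': "C' \<subseteq> {0..h}" "0 \<in> C'" "h \<in> C'" "h + (int (card A') + int (card B') - 1) < int CARD('p)"
      "of_int ` C' = (\<lambda>x. x - \<gamma>) ` ?D" "card C' = card ?D" by blast
  have "of_int ` C' = (\<lambda>x. x - (\<gamma> - (\<alpha> + \<beta>))) ` C" unfolding C'(5) by (auto simp: image_image algebra_simps)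
  moreover have "card C' = card C" unfolding C'(6) by (simp add: card_image)
  moreover have "h + int (card A') + int (card B') \<le> int CARD('p)" using C'(4) by linarith
  ultimately show "\<exists>\<gamma> h C'. C' \<subseteq> {0..h} \<and> 0 \<in> C' \<and> h \<in> C' \<and> h + int (card A') + int (card B') \<le> int CARD('p) \<and>
      of_int ` C' = (\<lambda>x. x - \<gamma>) ` C \<and> card C' = card C" using C'(1-3) by blast
qed

section \<open>Three sets without zero sums\<close>

text \<open>\<open>A + B\<close> and the negatives of \<open>C\<close> are disjoint.\<close>

lemma card_sumset_complement:
  fixes A B C :: "'p::nontriv mod_ring set"
  assumes "\<And>x. x \<in> C \<Longrightarrow> - x \<notin> A + B"
  shows "card (A + B) + card C \<le> CARD('p)"
proof -
  have "(A + B) \<inter> uminus ` C = {}" using assms by auto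
  then have "card (A + B) + card (uminus ` C) = card ((A + B) \<union> uminus ` C)" by (simp add: card_Un_disjoint)
  also have "\<dots> \<le> card (UNIV :: 'p mod_ring set)" by (intro card_mono) auto
  finally show ?thesis by (simp add: card_image)
qed

text \<open>The condition says that \<open>a + b + c\<close> is never 0, which is symmetric in the
  three sets.\<close>

lemma sumset_avoid_rotate:
  fixes A B C :: "'a::ab_group_add set"
  assumes "\<And>x. x \<in> C \<Longrightarrow> - x \<notin> A + B" "x \<in> B"
  shows "- x \<notin> A + C"
proof
  assume "- x \<in> A + C"
  then obtain a c where ac: "a \<in> A" "c \<in> C" "- x = a + c" by (rule set_plus_elim)
  then have "- c = a + x" by (simp add: algebra_simps eq_neg_iff_add_eq_0 neg_eq_iff_add_eq_0)
  then have "- c \<in> A + B" using ac assms(2) by (metis set_plus_intro)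
  then show False using assms(1)[OF ac(2)] by simp
qed

lemma Gcd_int_union_eq_1:
  fixes A B :: "int set"
  assumes "Gcd A = 1" shows "Gcd (A \<union> B) = 1"
proof -
  have "Gcd (A \<union> B) dvd Gcd A" by (rule Gcd_greatest) (simp add: Gcd_dvd)
  then have "is_unit (Gcd (A \<union> B))" using assms by simp
  moreover have "0 \<le> Gcd (A \<union> B)" by (rule Gcd_int_greater_eq_0)
  ultimately show ?thesis by (simp add: zdvd1_eq)
qed

text \<open>At the start only the parts \<open>A'\<close> and \<open>B'\<close> are lifted. Three
  passes of \<open>rectification_step\<close> lift all of \<open>C\<close>, then all of
  \<open>B\<close>, then all of \<open>A\<close>; each pass supplies the diameter and gcd facts for
  the next.\<close>

theorem rectification:
  fixes A B C :: "'p::nontriv mod_ring set" and A' B' :: "int set"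
  assumes A: "A' \<subseteq> {0..l}" "0 \<in> A'" "l \<in> A'" "of_int ` A' \<subseteq> (\<lambda>x. x - \<alpha>) ` A"
    and B: "B' \<subseteq> {0..m}" "0 \<in> B'" "m \<in> B'" "of_int ` B' \<subseteq> (\<lambda>x. x - \<beta>) ` B"
    and lm: "l + m < int CARD('p)" and g: "Gcd (A' \<union> B') = 1"
    and small: "card (A + B) + 4 \<le> card A' + card B' + min (card A') (card B')"
    and C: "C = uminus ` (UNIV - (A + B))" "C \<noteq> {}"
    and small1: "CARD('p) + 4 \<le> card B + card A' + 2 * card C"
    and small2: "CARD('p) + 4 \<le> card A + 2 * card B + card C" "CARD('p) + 4 \<le> card A + card B + 2 * card C"
  shows "\<exists>\<alpha> h. A \<subseteq> (\<lambda>n. \<alpha> + of_nat n) ` {0..h} \<and> h + card B + card C \<le> CARD('p)"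
    and "\<exists>\<beta> h. B \<subseteq> (\<lambda>n. \<beta> + of_nat n) ` {0..h} \<and> h + card A + card C \<le> CARD('p)"
    and "\<exists>\<gamma> h. C \<subseteq> (\<lambda>n. \<gamma> + of_nat n) ` {0..h} \<and> h + card A + card B \<le> CARD('p)"
proof -
  have ABC: "\<And>x. x \<in> C \<Longrightarrow> - x \<notin> A + B" using C(1) by auto
  have ACB: "\<And>x. x \<in> B \<Longrightarrow> - x \<notin> A + C" using sumset_avoid_rotate[OF ABC] .
  have "\<And>x. x \<in> B \<Longrightarrow> - x \<notin> C + A" using ACB by (simp add: add.commute)
  then have CBA: "\<And>x. x \<in> A \<Longrightarrow> - x \<notin> C + B" by (rule sumset_avoid_rotate)
  have AB_eq: "card (A + B) + card C = CARD('p)"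
    using card_mono[of UNIV "A + B"] unfolding C(1) by (simp add: card_image card_Diff_subset)
  have le1: "card (A + C) + card B \<le> CARD('p)" by (rule card_sumset_complement) (rule ACB)
  have le2: "card (C + B) + card A \<le> CARD('p)" by (rule card_sumset_complement) (rule CBA)
  have cA: "card A' \<le> card A" and cB: "card B' \<le> card B"
  proof -
    have "0 \<le> l" "0 \<le> m" using A B by auto
    then have "A' \<subseteq> {0..l + m}" "B' \<subseteq> {0..l + m}" using A(1) B(1) by auto
    moreover have inj: "inj_on (of_int :: int \<Rightarrow> 'p mod_ring) {0..l + m}"
      by (rule inj_on_of_int_mod_ring) (use lm in simp)
    ultimately have "inj_on (of_int :: int \<Rightarrow> 'p mod_ring) A'" "inj_on (of_int :: int \<Rightarrow> 'p mod_ring) B'"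
      by (meson inj_on_subset)+
    then have "card A' \<le> card ((\<lambda>x. x - \<alpha>) ` A)" "card B' \<le> card ((\<lambda>x. x - \<beta>) ` B)"
      using A(4) B(4) by (metis card_image card_mono finite)+
    then show "card A' \<le> card A" "card B' \<le> card B" by (simp_all add: card_image inj_on_def)
  qed
  have ne: "A \<noteq> {}" "B \<noteq> {}" using A(2,4) B(2,4) by auto
  note 1 = rectification_step[OF A B lm g small C(2) ABC]
  from 1(5) obtain \<gamma> hc C' where C': "C' \<subseteq> {0..hc}" "0 \<in> C'" "hc \<in> C'"
    "hc + int (card A') + int (card B') \<le> int CARD('p)" "of_int ` C' = (\<lambda>x. x - \<gamma>) ` C" "card C' = card C"
    by blast
  have C'': "of_int ` C' \<subseteq> (\<lambda>x. x - \<gamma>) ` C" using C'(5) by simp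
  \<comment> \<open>Adding the bounds on \<open>l\<close> and \<open>hc\<close> and using
    \<open>small\<close> gives \<open>l + hc \<le> CARD('p) - 4\<close>.\<close>
  have lm2: "l + hc < int CARD('p)" using 1(1) small C'(4) by linarith
  have g2: "Gcd (A' \<union> C') = 1" using 1(3) by (rule Gcd_int_union_eq_1)
  \<comment> \<open>If the minimum is \<open>card C'\<close>, this is \<open>small1\<close>. If it
    is \<open>card A'\<close>, it follows from \<open>small\<close>, because
    \<open>card (A + C) \<le> card (A + B) + card C - card B\<close> and
    \<open>card B' \<le> card B\<close>.\<close>
  have small': "card (A + C) + 4 \<le> card A' + card C' + min (card A') (card C')"
    using le1 small1 AB_eq small cB unfolding C'(6) by linarith
  note 2 = rectification_step[OF A C'(1-3) C'' lm2 g2 small' ne(2) ACB]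
  from 2(5) obtain \<beta>' hb B2 where B2: "B2 \<subseteq> {0..hb}" "0 \<in> B2" "hb \<in> B2"
    "hb + int (card A') + int (card C') \<le> int CARD('p)" "of_int ` B2 = (\<lambda>x. x - \<beta>') ` B" "card B2 = card B"
    by blast
  have B2': "of_int ` B2 \<subseteq> (\<lambda>x. x - \<beta>') ` B" using B2(5) by simp
  have lm3: "hc + hb < int CARD('p)" using 2(2) B2(4) le1 small AB_eq cB unfolding C'(6) by linarith
  have g3: "Gcd (C' \<union> B2) = 1" using 2(4) by (rule Gcd_int_union_eq_1)
  have small'': "card (C + B) + 4 \<le> card C' + card B2 + min (card C') (card B2)"
    using le2 small2 unfolding C'(6) B2(6) by linarith
  note 3 = rectification_step[OF C'(1-3) C'' B2(1-3) B2' lm3 g3 small'' ne(1) CBA]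
  from 3(5) obtain \<alpha>' ha A2 where A2: "A2 \<subseteq> {0..ha}" "0 \<in> A2" "ha \<in> A2"
    "ha + int (card C') + int (card B2) \<le> int CARD('p)" "of_int ` A2 = (\<lambda>x. x - \<alpha>') ` A" "card A2 = card A"
    by blast
  have fin: "X \<subseteq> (\<lambda>n. \<delta> + of_nat n) ` {0..nat h}" if X: "of_int ` Y = (\<lambda>x. x - \<delta>) ` X" "Y \<subseteq> {0..h}"
    for X :: "'p mod_ring set" and Y \<delta> h
  proof
    fix x assume "x \<in> X"
    then have "x - \<delta> \<in> of_int ` Y" using X(1) by blast
    then obtain n where n: "n \<in> Y" "x - \<delta> = of_int n" by auto
    then have "0 \<le> n" "n \<le> h" using X(2) by auto
    then have "x = \<delta> + of_nat (nat n)" "nat n \<in> {0..nat h}" using n(2) by (auto simp: algebra_simps)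
    then show "x \<in> (\<lambda>n. \<delta> + of_nat n) ` {0..nat h}" by blast
  qed
  have h0: "0 \<le> ha" "0 \<le> hb" "0 \<le> hc" using A2 B2 C' by auto
  have "nat ha + card B + card C \<le> CARD('p)" using A2(4) h0 unfolding C'(6) B2(6) by linarith
  then show "\<exists>\<alpha> h. A \<subseteq> (\<lambda>n. \<alpha> + of_nat n) ` {0..h} \<and> h + card B + card C \<le> CARD('p)"
    using fin[OF A2(5,1)] by blast
  \<comment> \<open>The bounds for \<open>B\<close> and \<open>C\<close> come from the diameters in
    the third pass, where both sets are lifted in full, and from
    \<open>card (C + B) \<le> CARD('p) - card A\<close>.\<close>
  have "nat hb + card A + card C \<le> CARD('p)" using 3(2) le2 h0 unfolding C'(6) B2(6) by linarith
  then show "\<exists>\<beta> h. B \<subseteq> (\<lambda>n. \<beta> + of_nat n) ` {0..h} \<and> h + card A + card C \<le> CARD('p)"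
    using fin[OF B2(5,1)] by blast
  have "nat hc + card A + card B \<le> CARD('p)" using 3(1) le2 h0 unfolding C'(6) B2(6) by linarith
  then show "\<exists>\<gamma> h. C \<subseteq> (\<lambda>n. \<gamma> + of_nat n) ` {0..h} \<and> h + card A + card B \<le> CARD('p)"
    using fin[OF C'(5,1)] by blast
qed

section \<open>Large Fourier coefficients\<close>

text \<open>For \<open>\<theta>\<close> in \<open>{0..pi}\<close> the sign factor is - 1 before
  \<open>\<theta>\<close> and 1 after it. Shifting \<open>\<theta>\<close> by a multiple of
  \<open>pi\<close> multiplies both sides by the same sign.\<close>

lemma has_integral_sin_mult_sgn:
  "((\<lambda>\<phi>. sin \<phi> * sgn (sin (\<phi> - \<theta>))) has_integral 2 * cos \<theta>) {0..pi}"
proof -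
  have base: "((\<lambda>\<phi>. sin \<phi> * sgn (sin (\<phi> - t))) has_integral 2 * cos t) {0..pi}"
    if t: "0 \<le> t" "t \<le> pi" for t
  proof -
    have "((\<lambda>\<phi>. - sin \<phi>) has_integral (cos t - cos 0)) {0..t}"
      by (rule fundamental_theorem_of_calculus)
        (use t in \<open>auto intro!: derivative_eq_intros simp flip: has_real_derivative_iff_has_vector_derivative\<close>)
    then have 1: "((\<lambda>\<phi>. sin \<phi> * sgn (sin (\<phi> - t))) has_integral (cos t - cos 0)) {0..t}"
    proof (rule has_integral_spike_finite[rotated 2])
      fix \<phi> assume "\<phi> \<in> {0..t} - {0, t}"
      then have "0 < sin (t - \<phi>)" using t by (intro sin_gt_zero) auto
      then have "sin (\<phi> - t) < 0" by (metis minus_diff_eq neg_less_0_iff_less sin_minus)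
      then show "sin \<phi> * sgn (sin (\<phi> - t)) = - sin \<phi>" by simp
    qed simp
    have "((\<lambda>\<phi>. sin \<phi>) has_integral (- cos pi - (- cos t))) {t..pi}"
      by (rule fundamental_theorem_of_calculus)
        (use t in \<open>auto intro!: derivative_eq_intros simp flip: has_real_derivative_iff_has_vector_derivative\<close>)
    then have 2: "((\<lambda>\<phi>. sin \<phi> * sgn (sin (\<phi> - t))) has_integral (- cos pi - (- cos t))) {t..pi}"
    proof (rule has_integral_spike_finite[rotated 2])
      fix \<phi> assume "\<phi> \<in> {t..pi} - {t, t + pi}"
      then have "0 < sin (\<phi> - t)" using t by (intro sin_gt_zero) auto
      then show "sin \<phi> * sgn (sin (\<phi> - t)) = sin \<phi>" by simp
    qed simp
    show ?thesis using has_integral_combine[OF t 1 2] by (simp add: algebra_simps)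
  qed
  define k where "k = \<lfloor>\<theta> / pi\<rfloor>"
  define t where "t = \<theta> - pi * k"
  have "of_int k \<le> \<theta> / pi" "\<theta> / pi < of_int k + 1" unfolding k_def by linarith+
  then have t: "0 \<le> t" "t \<le> pi" by (auto simp: t_def field_simps)
  have "sin (\<phi> - \<theta>) = sin (\<phi> - t) * (if even k then 1 else - 1)" for \<phi>
  proof -
    have "\<phi> - \<theta> = (\<phi> - t) - pi * k" by (simp add: t_def)
    then have "sin (\<phi> - \<theta>) = sin ((\<phi> - t) - pi * k)" by (rule arg_cong)
    also have "\<dots> = sin (\<phi> - t) * cos (pi * k) - cos (\<phi> - t) * sin (pi * k)" by (rule sin_diff)
    finally show ?thesis by simp
  qed
  moreover have "cos \<theta> = cos t * (if even k then 1 else - 1)"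
  proof -
    have "\<theta> = t + pi * k" by (simp add: t_def)
    then show ?thesis by (simp add: cos_add)
  qed
  ultimately show ?thesis
    using base[OF t] has_integral_neg[OF base[OF t]] by (cases "even k") (simp_all add: sgn_minus)
qed

text \<open>The previous integral averages over half circles with weight \<^term>\<open>sin\<close>, so some half circle
  does at least as well as the average.\<close>

lemma half_circle_count:
  fixes \<theta> :: "'b \<Rightarrow> real"
  assumes "finite I"
  shows "\<exists>\<phi>. norm (\<Sum>j\<in>I. cis (\<theta> j)) + card I \<le> 2 * card {j \<in> I. 0 \<le> sin (\<phi> - \<theta> j)}"
proof -
  define z where "z = (\<Sum>j\<in>I. cis (\<theta> j))"
  define \<omega> where "\<omega> = Arg z"
  \<comment> \<open>Rotation by \<open>- \<omega>\<close> makes the sum real, so that only the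
    cosines remain.\<close>
  have "z = rcis (norm z) \<omega>" by (simp add: \<omega>_def rcis_cmod_Arg)
  then have "z * cis (- \<omega>) = rcis (norm z) \<omega> * cis (- \<omega>)" by (rule arg_cong)
  then have "of_real (norm z) = z * cis (- \<omega>)" by (simp add: rcis_def cis_mult mult.assoc)
  also have "\<dots> = (\<Sum>j\<in>I. cis (\<theta> j - \<omega>))" by (simp add: z_def sum_distrib_right cis_mult)
  finally have R: "norm z = (\<Sum>j\<in>I. cos (\<theta> j - \<omega>))" by (metis (no_types, lifting) Re_complex_of_real Re_sum cis.sel(1) sum.cong)
  define N where "N \<phi> = card {j \<in> I. 0 \<le> sin (\<phi> - \<theta> j)}" for \<phi>
  have "range N \<subseteq> {..card I}" using assms by (auto simp: N_def intro: card_mono)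
  then have fin: "finite (range N)" by (meson finite_atMost finite_subset)
  then have "Max (range N) \<in> range N" by (intro Max_in) auto
  then obtain \<phi>0 where \<phi>0: "N \<phi>0 = Max (range N)" by (metis imageE)
  have sgn_le: "(\<Sum>j\<in>I. sgn (sin (\<phi> - (\<theta> j - \<omega>)))) \<le> 2 * real (N \<phi>0) - card I" for \<phi>
  proof -
    \<comment> \<open>\<open>N\<close> counts boundary points, where \<open>sgn\<close> is 0, in
      full; this only enlarges the right-hand side.\<close>
    have "(\<Sum>j\<in>I. sgn (sin (\<phi> - (\<theta> j - \<omega>)))) \<le> (\<Sum>j\<in>I. 2 * (if 0 \<le> sin ((\<phi> + \<omega>) - \<theta> j) then 1 else 0) - 1)"
      by (intro sum_mono) (auto simp: sgn_if algebra_simps)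
    also have "\<dots> = 2 * real (N (\<phi> + \<omega>)) - card I"
      using assms by (simp add: sum_subtractf sum_distrib_left[symmetric] N_def sum.If_cases Int_def)
    also have "N (\<phi> + \<omega>) \<le> N \<phi>0" unfolding \<phi>0 using fin by simp
    finally show ?thesis by simp
  qed
  have "((\<lambda>\<phi>. \<Sum>j\<in>I. sin \<phi> * sgn (sin (\<phi> - (\<theta> j - \<omega>)))) has_integral (\<Sum>j\<in>I. 2 * cos (\<theta> j - \<omega>))) {0..pi}"
    by (intro has_integral_sum assms has_integral_sin_mult_sgn)
  then have i1: "((\<lambda>\<phi>. \<Sum>j\<in>I. sin \<phi> * sgn (sin (\<phi> - (\<theta> j - \<omega>)))) has_integral 2 * norm z) {0..pi}"
    by (simp add: R sum_distrib_left)
  have "((\<lambda>\<phi>. sin \<phi>) has_integral (- cos pi - (- cos 0))) {0..pi}"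
    by (rule fundamental_theorem_of_calculus)
      (auto intro!: derivative_eq_intros simp flip: has_real_derivative_iff_has_vector_derivative)
  then have "((\<lambda>\<phi>. sin \<phi>) has_integral 2) {0..pi}" by simp
  from has_integral_mult_left[OF this, of "2 * real (N \<phi>0) - card I"]
  have i2: "((\<lambda>\<phi>. sin \<phi> * (2 * real (N \<phi>0) - card I)) has_integral 2 * (2 * real (N \<phi>0) - card I)) {0..pi}" .
  \<comment> \<open>The bound \<open>sgn_le\<close> is integrated against the weight
    \<open>sin\<close>, of total mass 2 on \<open>{0..pi}\<close>.\<close>
  have "2 * norm z \<le> 2 * (2 * real (N \<phi>0) - card I)"
  proof (rule has_integral_le[OF i1 i2])
    fix \<phi> assume "\<phi> \<in> {0..pi}"
    then show "(\<Sum>j\<in>I. sin \<phi> * sgn (sin (\<phi> - (\<theta> j - \<omega>)))) \<le> sin \<phi> * (2 * real (N \<phi>0) - card I)"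
      unfolding sum_distrib_left[symmetric] by (intro mult_left_mono sgn_le) (auto intro: sin_ge_zero)
  qed
  then show ?thesis unfolding z_def[symmetric] by (intro exI[of _ \<phi>0]) (simp add: N_def)
qed

lemma sin_ge_0_imp:
  assumes "0 \<le> sin z"
  shows "\<exists>t::int. 0 \<le> z - 2 * pi * t \<and> z - 2 * pi * t \<le> pi"
proof -
  define t where "t = \<lfloor>z / (2 * pi)\<rfloor>"
  have "of_int t \<le> z / (2 * pi)" "z / (2 * pi) < of_int t + 1" unfolding t_def by linarith+
  then have t: "0 \<le> z - 2 * pi * t" "z - 2 * pi * t < 2 * pi" by (auto simp: field_simps)
  have "sin (z - 2 * pi * t) = sin z"
    using sin_npi_int[of "2 * t"] cos_npi_int[of "2 * t"] by (simp add: sin_diff algebra_simps)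
  then have "\<not> pi < z - 2 * pi * t" using sin_lt_zero[of "z - 2 * pi * t"] t assms by auto
  then show ?thesis using t by (intro exI[of _ t]) auto
qed

section \<open>Additive characters and Fourier coefficients\<close>

text \<open>The standard additive character modulo \<open>CARD('p)\<close>; multiplying its argument
  by \<open>k\<close> gives the others.\<close>

definition mod_cis :: "'p::nontriv mod_ring \<Rightarrow> complex" where
  "mod_cis x = cis (2 * pi * to_int_mod_ring x / CARD('p))"

lemma mod_cis_of_int: "mod_cis (of_int n :: 'p::nontriv mod_ring) = cis (2 * pi * n / CARD('p))"
proof -
  define p where "p = int CARD('p)"
  have p: "p > 0" by (simp add: p_def)
  have t: "to_int_mod_ring (of_int n :: 'p mod_ring) = n mod p"
    unfolding p_def by transfer simp
  have "2 * pi * n / p = 2 * pi * of_int (n mod p) / p + 2 * pi * of_int (n div p)"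
  proof -
    have "real_of_int n = of_int (n mod p) + of_int p * of_int (n div p)"
      by (metis of_int_add of_int_mult mod_mult_div_eq)
    then show ?thesis using p by (simp add: field_simps)
  qed
  then have "cis (2 * pi * n / p) = cis (2 * pi * of_int (n mod p) / p + 2 * pi * of_int (n div p))"
    by (rule arg_cong)
  also have "\<dots> = cis (2 * pi * of_int (n mod p) / p)" by (simp flip: cis_mult)
  finally show ?thesis by (simp add: mod_cis_def t p_def)
qed

lemma mod_cis_add: "mod_cis (x + y) = mod_cis x * mod_cis y"
proof -
  have "mod_cis (of_int (to_int_mod_ring x + to_int_mod_ring y) :: 'a mod_ring) = mod_cis x * mod_cis y"
    unfolding mod_cis_of_int by (simp add: mod_cis_def cis_mult ring_distribs add_divide_distrib)
  then show ?thesis by simp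
qed

lemma mod_cis_0 [simp]: "mod_cis 0 = 1"
  by (simp add: mod_cis_def)

lemma cnj_mod_cis: "cnj (mod_cis x) = mod_cis (- x)"
proof -
  have "mod_cis (of_int (- to_int_mod_ring x) :: 'a mod_ring) = cnj (mod_cis x)"
    unfolding mod_cis_of_int by (simp add: mod_cis_def cis_cnj)
  then show ?thesis by simp
qed

lemma mod_cis_neq_1:
  fixes x :: "'p::nontriv mod_ring"
  assumes "x \<noteq> 0" shows "mod_cis x \<noteq> 1"
proof
  assume "mod_cis x = 1"
  then have "cos (2 * pi * to_int_mod_ring x / CARD('p)) = 1"
    by (metis cis.sel(1) mod_cis_def one_complex.sel(1))
  then obtain n :: int where "2 * pi * to_int_mod_ring x / CARD('p) = of_int n * 2 * pi"
    by (auto simp: cos_one_2pi_int)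
  then have "real_of_int (to_int_mod_ring x) = of_int (n * int CARD('p))" by (simp add: field_simps)
  then have "to_int_mod_ring x = n * int CARD('p)" by (simp only: of_int_eq_iff)
  then have "of_int (to_int_mod_ring x) = (0 :: 'p mod_ring)" by simp
  then show False using assms by simp
qed

text \<open>Orthogonality: replacing \<open>k\<close> by \<open>k + 1\<close> multiplies the sum by
  \<open>mod_cis x\<close>, which differs from 1 for nonzero \<open>x\<close>.\<close>

lemma sum_mod_cis:
  fixes x :: "'p::prime_card mod_ring"
  shows "(\<Sum>k\<in>UNIV. mod_cis (k * x)) = (if x = 0 then of_nat CARD('p) else 0)"
proof (cases "x = 0")
  case False
  have "(\<Sum>k\<in>UNIV. mod_cis (k * x)) = (\<Sum>k\<in>UNIV. mod_cis ((k + 1) * x))"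
    by (rule sum.reindex_bij_witness[of _ "\<lambda>k. k + 1" "\<lambda>k. k - 1"]) auto
  also have "\<dots> = mod_cis x * (\<Sum>k\<in>UNIV. mod_cis (k * x))"
    by (simp add: ring_distribs mod_cis_add sum_distrib_left mult.commute)
  finally show ?thesis using mod_cis_neq_1[OF False] False by simp
qed simp

definition fourier :: "'p::nontriv mod_ring set \<Rightarrow> 'p mod_ring \<Rightarrow> complex" where
  "fourier A k = (\<Sum>x\<in>A. mod_cis (k * x))"

lemma fourier_0: "fourier A 0 = of_nat (card A)"
  by (simp add: fourier_def)

text \<open>Orthogonality leaves only the triples with \<open>s = a + b\<close>, one for each pair
  \<open>a\<close>, \<open>b\<close>.\<close>

lemma sum_fourier_triple:
  fixes A B :: "'p::prime_card mod_ring set"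
  shows "(\<Sum>k\<in>UNIV. fourier A k * fourier B k * cnj (fourier (A + B) k)) = of_nat (CARD('p) * card A * card B)"
proof -
  have "(\<Sum>k\<in>UNIV. fourier A k * fourier B k * cnj (fourier (A + B) k))
    = (\<Sum>k\<in>UNIV. \<Sum>a\<in>A. \<Sum>b\<in>B. \<Sum>s\<in>A + B. mod_cis (k * (a + b - s)))"
    unfolding fourier_def
    by (rule sum.cong[OF refl], subst sum.swap)
      (simp add: sum_product sum_distrib_left sum_distrib_right cnj_mod_cis mod_cis_add[symmetric] algebra_simps)
  also have "\<dots> = (\<Sum>a\<in>A. \<Sum>k\<in>UNIV. \<Sum>b\<in>B. \<Sum>s\<in>A + B. mod_cis (k * (a + b - s)))"
    by (rule sum.swap)
  also have "\<dots> = (\<Sum>a\<in>A. \<Sum>b\<in>B. \<Sum>k\<in>UNIV. \<Sum>s\<in>A + B. mod_cis (k * (a + b - s)))"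
    by (rule sum.cong[OF refl]) (rule sum.swap)
  also have "\<dots> = (\<Sum>a\<in>A. \<Sum>b\<in>B. \<Sum>s\<in>A + B. \<Sum>k\<in>UNIV. mod_cis (k * (a + b - s)))"
    by (rule sum.cong[OF refl], rule sum.cong[OF refl]) (rule sum.swap)
  also have "\<dots> = (\<Sum>a\<in>A. \<Sum>b\<in>B. \<Sum>s\<in>A + B. if s = a + b then of_nat CARD('p) else 0)"
    unfolding sum_mod_cis by (intro sum.cong refl) auto
  also have "\<dots> = (\<Sum>a\<in>A. \<Sum>b\<in>B. of_nat CARD('p))"
    by (intro sum.cong refl) (auto simp: sum.delta)
  finally show ?thesis by simp
qed

lemma Parseval:
  fixes A :: "'p::prime_card mod_ring set"
  shows "(\<Sum>k\<in>UNIV. (norm (fourier A k))\<^sup>2) = CARD('p) * card A"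
proof -
  have "complex_of_real (\<Sum>k\<in>UNIV. (norm (fourier A k))\<^sup>2) = (\<Sum>k\<in>UNIV. fourier A k * fourier {0} k * cnj (fourier (A + {0}) k))"
    unfolding of_real_sum
  proof (rule sum.cong[OF refl])
    fix k :: "'p mod_ring"
    have "fourier {0} k = 1" "A + {0} = A" by (simp_all add: fourier_def)
    then show "complex_of_real ((norm (fourier A k))\<^sup>2) = fourier A k * fourier {0} k * cnj (fourier (A + {0}) k)"
      by (simp only: complex_norm_square mult_1_right)
  qed
  also have "\<dots> = of_real (CARD('p) * card A)"
    unfolding sum_fourier_triple by simp
  finally show ?thesis by (simp only: of_real_eq_iff)
qed

lemma Parseval_nonzero:
  fixes A :: "'p::prime_card mod_ring set"
  shows "(\<Sum>k\<in>UNIV - {0}. (norm (fourier A k))\<^sup>2) = card A * (real CARD('p) - card A)"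
proof -
  have "(\<Sum>k\<in>UNIV. (norm (fourier A k))\<^sup>2) = (norm (fourier A 0))\<^sup>2 + (\<Sum>k\<in>UNIV - {0}. (norm (fourier A k))\<^sup>2)"
    by (rule sum.remove) auto
  then show ?thesis unfolding Parseval by (simp add: fourier_0 power2_eq_square algebra_simps)
qed

text \<open>The trivial character contributes \<open>a * b * s\<close> to the total
  \<open>p * a * b\<close>, so the others contribute \<open>a * b * (p - s)\<close>. If each of them
  had a small coefficient at \<open>A\<close> or at \<open>B\<close>, the squared product of the two
  would be at most the sum of both one-sided bounds, and Cauchy-Schwarz with Parseval would
  contradict \<open>big\<close>.\<close>

lemma large_fourier_coefficients:
  fixes A B :: "'p::prime_card mod_ring set" and u v :: real
  defines "a \<equiv> real (card A)" and "b \<equiv> real (card B)" and "s \<equiv> real (card (A + B))" and "p \<equiv> real CARD('p)"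
  assumes big: "(u\<^sup>2 * (b * (p - b)) + v\<^sup>2 * (a * (p - a))) * (s * (p - s)) < (a * b * (p - s))\<^sup>2"
  shows "\<exists>k. k \<noteq> 0 \<and> u < norm (fourier A k) \<and> v < norm (fourier B k)"
proof (rule ccontr)
  assume none: "\<not> ?thesis"
  let ?U = "UNIV - {0 :: 'p mod_ring}"
  let ?w = "\<lambda>k. norm (fourier A k) * norm (fourier B k)" and ?z = "\<lambda>k. norm (fourier (A + B) k)"
  have w: "(?w k)\<^sup>2 \<le> u\<^sup>2 * (norm (fourier B k))\<^sup>2 + v\<^sup>2 * (norm (fourier A k))\<^sup>2" if "k \<in> ?U" for k
  proof -
    from that none consider "norm (fourier A k) \<le> u" | "norm (fourier B k) \<le> v" by force
    then show ?thesis
    proof cases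
      case 1
      then have "(norm (fourier A k))\<^sup>2 \<le> u\<^sup>2" by (intro power_mono) auto
      then have "(?w k)\<^sup>2 \<le> u\<^sup>2 * (norm (fourier B k))\<^sup>2" by (simp add: power_mult_distrib mult_right_mono)
      then show ?thesis by (simp add: add_increasing2)
    next
      case 2
      then have "(norm (fourier B k))\<^sup>2 \<le> v\<^sup>2" by (intro power_mono) auto
      then have "(norm (fourier A k))\<^sup>2 * (norm (fourier B k))\<^sup>2 \<le> (norm (fourier A k))\<^sup>2 * v\<^sup>2"
        by (rule mult_left_mono) simp
      then have "(?w k)\<^sup>2 \<le> v\<^sup>2 * (norm (fourier A k))\<^sup>2" by (simp add: power_mult_distrib mult.commute)
      then show ?thesis by (simp add: add_increasing)
    qed
  qed
  have "(\<Sum>k\<in>UNIV. fourier A k * fourier B k * cnj (fourier (A + B) k))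
    = of_nat (card A) * of_nat (card B) * of_nat (card (A + B)) + (\<Sum>k\<in>?U. fourier A k * fourier B k * cnj (fourier (A + B) k))"
    by (subst sum.remove[of _ 0]) (auto simp: fourier_0)
  then have "(\<Sum>k\<in>?U. fourier A k * fourier B k * cnj (fourier (A + B) k)) = of_real (a * b * (p - s))"
    unfolding sum_fourier_triple by (simp add: a_def b_def s_def p_def algebra_simps)
  then have "\<bar>a * b * (p - s)\<bar> = norm (\<Sum>k\<in>?U. fourier A k * fourier B k * cnj (fourier (A + B) k))"
    by (metis norm_of_real)
  also have "\<dots> \<le> (\<Sum>k\<in>?U. ?w k * ?z k)"
    by (rule order_trans[OF norm_sum]) (simp add: norm_mult)
  finally have "\<bar>a * b * (p - s)\<bar>\<^sup>2 \<le> (\<Sum>k\<in>?U. ?w k * ?z k)\<^sup>2" by (rule power_mono) simp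
  also have "\<dots> \<le> (\<Sum>k\<in>?U. (?w k)\<^sup>2) * (\<Sum>k\<in>?U. (?z k)\<^sup>2)" by (rule Cauchy_Schwarz_ineq_sum)
  also have "\<dots> \<le> (\<Sum>k\<in>?U. u\<^sup>2 * (norm (fourier B k))\<^sup>2 + v\<^sup>2 * (norm (fourier A k))\<^sup>2) * (\<Sum>k\<in>?U. (?z k)\<^sup>2)"
    by (intro mult_right_mono sum_mono w sum_nonneg) auto
  also have "\<dots> = (u\<^sup>2 * (b * (p - b)) + v\<^sup>2 * (a * (p - a))) * (s * (p - s))"
    by (simp only: sum.distrib sum_distrib_left[symmetric] Parseval_nonzero a_def b_def s_def p_def)
  finally show False using big by simp
qed

text \<open>Unwound, a closed half circle becomes a real interval of length
  \<open>CARD('p) / 2\<close>. As \<open>CARD('p)\<close> is odd, it contains at most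
  \<open>(CARD('p) + 1) / 2\<close> integers.\<close>

lemma arc_count:
  fixes A :: "'p::prime_card mod_ring set"
  assumes k: "k \<noteq> 0" and odd: "odd CARD('p)"
  shows "\<exists>u. norm (fourier A k) + card A
    \<le> 2 * card {n \<in> {u..u + (int CARD('p) - 1) div 2}. of_int n \<in> (*) k ` A}"
proof -
  define p where "p = int CARD('p)"
  have p: "p > 0" by (simp add: p_def)
  define \<theta> where "\<theta> x = 2 * pi * to_int_mod_ring (k * x) / p" for x :: "'p mod_ring"
  obtain \<phi> where \<phi>: "norm (\<Sum>x\<in>A. cis (\<theta> x)) + card A \<le> 2 * card {x \<in> A. 0 \<le> sin (\<phi> - \<theta> x)}"
    using half_circle_count[of A \<theta>] by auto
  \<comment> \<open>\<open>y\<close> is the angle \<open>\<phi>\<close> in units of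
    \<open>2 * pi / p\<close>, and \<open>u\<close> is the first integer in the half circle ending
    at \<open>y\<close>.\<close>
  define y where "y = p * \<phi> / (2 * pi)"
  define u where "u = \<lceil>y - p / 2\<rceil>"
  let ?N = "{n \<in> {u..u + (p - 1) div 2}. of_int n \<in> (*) k ` A}"
  have "\<exists>n. n \<in> {u..u + (p - 1) div 2} \<and> of_int n = k * x" if x: "0 \<le> sin (\<phi> - \<theta> x)" for x
  proof -
    from sin_ge_0_imp[OF x] obtain t :: int
      where t: "0 \<le> \<phi> - \<theta> x - 2 * pi * t" "\<phi> - \<theta> x - 2 * pi * t \<le> pi" by auto
    define n where "n = to_int_mod_ring (k * x) + p * t"
    have e: "\<phi> - \<theta> x - 2 * pi * t = (y - n) * (2 * pi / p)"
      using p by (simp add: y_def \<theta>_def n_def field_simps)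
    have n: "n \<le> y" "y - p / 2 \<le> n"
    proof -
      have c: "0 < 2 * pi / p" using p by simp
      then show "n \<le> y" using t(1) unfolding e by (simp only: zero_le_mult_iff) auto
      have "(y - n) * (2 * pi / p) \<le> (p / 2) * (2 * pi / p)" using t(2) p unfolding e by simp
      then have "y - n \<le> p / 2" using c by (rule mult_right_le_imp_le)
      then show "y - p / 2 \<le> n" by simp
    qed
    have "real_of_int (n - u) \<le> p / 2" using n(1) unfolding u_def by linarith
    then have "real_of_int (2 * (n - u)) \<le> real_of_int p" by simp
    then have "2 * (n - u) \<le> p" by (simp only: of_int_le_iff)
    then have "n \<le> u + (p - 1) div 2" using odd unfolding p_def by presburger
    moreover have "u \<le> n" using n(2) unfolding u_def by linarith
    moreover have "of_int n = k * x" by (simp add: n_def p_def)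
    ultimately show ?thesis by auto
  qed
  then obtain g where g: "\<And>x. 0 \<le> sin (\<phi> - \<theta> x) \<Longrightarrow> g x \<in> {u..u + (p - 1) div 2} \<and> of_int (g x) = k * x"
    by metis
  have "card {x \<in> A. 0 \<le> sin (\<phi> - \<theta> x)} \<le> card ?N"
  proof (rule card_inj_on_le[of g])
    show "inj_on g {x \<in> A. 0 \<le> sin (\<phi> - \<theta> x)}"
    proof (rule inj_onI)
      fix x x' assume "x \<in> {x \<in> A. 0 \<le> sin (\<phi> - \<theta> x)}" "x' \<in> {x \<in> A. 0 \<le> sin (\<phi> - \<theta> x)}" "g x = g x'"
      then have "k * x = k * x'" using g[of x] g[of x'] by auto
      then show "x = x'" using k by simp
    qed
    show "g ` {x \<in> A. 0 \<le> sin (\<phi> - \<theta> x)} \<subseteq> ?N" using g by auto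
    show "finite ?N" by (rule finite_subset[of _ "{u..u + (p - 1) div 2}"]) auto
  qed
  moreover have "(\<Sum>x\<in>A. cis (\<theta> x)) = fourier A k" by (simp add: fourier_def mod_cis_def \<theta>_def p_def)
  ultimately show ?thesis using \<phi> by (intro exI[of _ u]) (simp add: p_def)
qed

section \<open>The density condition\<close>

definition c_beta_num :: "real \<Rightarrow> real \<Rightarrow> real" where
  "c_beta_num \<alpha> \<beta> = - 4 - (1 + 12 * \<alpha>) * \<beta> + 3 * (5 + \<alpha> - 4 * \<alpha>^2) * \<beta>^2
     + (- 1 + 3 * \<alpha> - 4 * \<alpha>^3) * \<beta>^3 - 4 * (1 + \<alpha>)^3 * \<beta>^4"

definition c_beta_den :: "real \<Rightarrow> real \<Rightarrow> real" where
  "c_beta_den \<alpha> \<beta> = - 4 + 11 * \<beta>^2 + 11 * \<beta>^3 - 4 * \<beta>^5 - 3 * \<alpha> * \<beta> * (4 - 5 * \<beta>^2 + 4 * \<beta>^4)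
     - 12 * \<alpha>^2 * (\<beta>^2 + \<beta>^5) - 4 * \<alpha>^3 * (\<beta>^3 + \<beta>^5)"

lemma c_beta_eq: "c_beta \<alpha> \<beta> = c_beta_num \<alpha> \<beta> / c_beta_den \<alpha> \<beta>"
  by (simp add: c_beta_def c_beta_num_def c_beta_den_def)

lemma c_one_eq: "c_one \<alpha> = c_beta \<alpha> 1"
  by (simp add: c_one_def c_beta_def algebra_simps power3_eq_cube power2_eq_square)

text \<open>With \<^term>\<open>c = a / p\<close>, \<^term>\<open>\<eta> = b / a\<close> and \<^term>\<open>\<sigma> = s / a\<close> the right-hand side is the
  margin in the Fourier-analytic estimate.\<close>

lemma c_beta_identity:
  fixes \<alpha> \<eta> c :: real
  defines "\<sigma> \<equiv> 1 + (1 + \<alpha>) * \<eta>"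
  shows "c_beta_num \<alpha> \<eta> - c * c_beta_den \<alpha> \<eta> =
    9 * \<eta>^2 * (1 - \<sigma> * c) - \<sigma> * ((1 - c) * (2 * \<sigma> - 3 * \<eta>)^2 + \<eta> * (1 - \<eta> * c) * (2 * \<sigma> - 3)^2)"
  unfolding c_beta_num_def c_beta_den_def \<sigma>_def
  by (simp add: algebra_simps eval_nat_numeral)

text \<open>Positivity allows the bound by \<open>c_beta \<alpha> \<beta>\<close> to be cleared of
  its denominator. The powers are estimated one by one with rounded rationals.\<close>

lemma c_beta_den_pos:
  assumes "0.731 \<le> \<beta>" "\<beta> \<le> 1" "0 \<le> \<alpha>" "\<alpha> \<le> 0.212"
  shows "0 < c_beta_den \<alpha> \<beta>"
proof -
  have \<alpha>\<beta>: "731 / 1000 \<le> \<beta>" "\<alpha> \<le> 53 / 250" using assms by simp_all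
  have b2: "(267 / 500) \<le> \<beta>^2" "\<beta>^2 \<le> 1"
    using assms \<alpha>\<beta> mult_mono[of "(731 / 1000)" \<beta> "(731 / 1000)" \<beta>] mult_le_one[of \<beta> \<beta>] by (auto simp: power2_eq_square)
  have b3: "(39 / 100) \<le> \<beta>^3" "\<beta>^3 \<le> 1"
    using assms \<alpha>\<beta> b2 mult_mono[of "(267 / 500)" "\<beta>^2" "(731 / 1000)" \<beta>] mult_le_one[of "\<beta>^2" \<beta>] by (auto simp: eval_nat_numeral)
  have b4: "\<beta>^4 \<le> \<beta>^2" "0 \<le> \<beta>^4"
    using assms \<alpha>\<beta> power_decreasing[of 2 4 \<beta>] by auto
  have b5: "\<beta>^5 \<le> \<beta>^3" "0 \<le> \<beta>^5"
    using assms \<alpha>\<beta> power_decreasing[of 3 5 \<beta>] by auto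
  have a2: "\<alpha>^2 \<le> (9 / 200)" "0 \<le> \<alpha>^2"
    using assms \<alpha>\<beta> mult_mono[of \<alpha> "(53 / 250)" \<alpha> "(53 / 250)"] by (auto simp: power2_eq_square)
  have a3: "\<alpha>^3 \<le> (6 / 625)" "0 \<le> \<alpha>^3"
    using assms \<alpha>\<beta> a2 mult_mono[of "\<alpha>^2" "(9 / 200)" \<alpha> "(53 / 250)"] by (auto simp: eval_nat_numeral)
  have ab: "0 \<le> \<alpha> * \<beta>" "\<alpha> * \<beta> \<le> (53 / 250)" using assms \<alpha>\<beta> mult_mono[of \<alpha> "(53 / 250)" \<beta> 1] by auto
  define x y z where "x = (\<alpha> * \<beta>) * (4 - 5 * \<beta>^2 + 4 * \<beta>^4)"
    and "y = \<alpha>^2 * (\<beta>^2 + \<beta>^5)" and "z = \<alpha>^3 * (\<beta>^3 + \<beta>^5)"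
  have "x \<le> (53 / 250) * (1733 / 500)" unfolding x_def
  proof (rule order_trans)
    show "(\<alpha> * \<beta>) * (4 - 5 * \<beta>^2 + 4 * \<beta>^4) \<le> (\<alpha> * \<beta>) * (4 - \<beta>^2)"
      using ab b2 b4 by (intro mult_left_mono) auto
    show "(\<alpha> * \<beta>) * (4 - \<beta>^2) \<le> (53 / 250) * (1733 / 500)"
      using ab b2 by (intro mult_mono) auto
  qed
  moreover have "y \<le> (9 / 200) * 2" unfolding y_def using a2 b2 b3 b5 by (intro mult_mono) auto
  moreover have "z \<le> (6 / 625) * 2" unfolding z_def using a3 b2 b3 b5 by (intro mult_mono) auto
  moreover have "c_beta_den \<alpha> \<beta> = - 4 + 11 * \<beta>^2 + 11 * \<beta>^3 - 4 * \<beta>^5 - 3 * x - 12 * y - 4 * z"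
    by (simp add: c_beta_den_def x_def y_def z_def algebra_simps)
  ultimately show ?thesis using b2 b3 b5 by linarith
qed

text \<open>The bound \<^term>\<open>0.731::real\<close> is what makes the second derivative of the numerator nonpositive.\<close>

lemma c_beta_concave:
  assumes \<alpha>: "0 \<le> \<alpha>" "\<alpha> \<le> 0.212" and c: "0 \<le> c" "c \<le> 5 / 14"
  shows "convex_on {0.731..1} (\<lambda>t. c * c_beta_den \<alpha> t - c_beta_num \<alpha> t)"
proof (rule f''_ge0_imp_convex)
  let ?f' = "\<lambda>t. c * (22 * t + 33 * t^2 - 20 * t^4 - 3 * \<alpha> * (4 - 15 * t^2 + 20 * t^4)
     - 12 * \<alpha>^2 * (2 * t + 5 * t^4) - 4 * \<alpha>^3 * (3 * t^2 + 5 * t^4))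
     - (- (1 + 12 * \<alpha>) + 6 * (5 + \<alpha> - 4 * \<alpha>^2) * t + 3 * (- 1 + 3 * \<alpha> - 4 * \<alpha>^3) * t^2 - 16 * (1 + \<alpha>)^3 * t^3)"
  let ?n = "\<lambda>t. 6 * (5 + \<alpha> - 4 * \<alpha>^2) + 6 * (- 1 + 3 * \<alpha> - 4 * \<alpha>^3) * t - 48 * (1 + \<alpha>)^3 * t^2"
  let ?d = "\<lambda>t. 22 + 66 * t - 80 * t^3 - 3 * \<alpha> * (- 30 * t + 80 * t^3)
     - 12 * \<alpha>^2 * (2 + 20 * t^3) - 4 * \<alpha>^3 * (6 * t + 20 * t^3)"
  show "DERIV (\<lambda>t. c * c_beta_den \<alpha> t - c_beta_num \<alpha> t) t :> ?f' t" if "t \<in> {0.731..1}" for t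
    unfolding c_beta_den_def c_beta_num_def
    by (auto intro!: derivative_eq_intros simp: algebra_simps eval_nat_numeral)
  show "DERIV ?f' t :> c * ?d t - ?n t" if "t \<in> {0.731..1}" for t
    by (auto intro!: derivative_eq_intros simp: algebra_simps eval_nat_numeral)
  show "0 \<le> c * ?d t - ?n t" if t: "t \<in> {0.731..1}" for t
  proof -
    have t1: "(731 / 1000) \<le> t" "t \<le> 1" using t by simp_all
    have t2: "(731 / 1000) * t \<le> t^2" "t^2 \<le> t" using t1 mult_right_mono[of "(731 / 1000)" t t] mult_left_le[of t t]
      by (auto simp: power2_eq_square)
    have t3: "t^3 \<le> t^2" "0 \<le> t^3" using t1 power_decreasing[of 2 3 t] by auto
    have n: "?n t \<le> 0"
    proof -
      define x y z where "x = \<alpha> * (1 + 3 * t - 24 * t^2)" and "y = \<alpha>^2 * (4 + 24 * t^2)"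
        and "z = \<alpha>^3 * (4 * t + 8 * t^2)"
      have eq: "?n t = 6 * ((5 - t - 8 * t^2) + x - y - z)"
        by (simp add: x_def y_def z_def algebra_simps eval_nat_numeral)
      have "x \<le> 0" unfolding x_def using \<alpha> t1 t2 by (intro mult_nonneg_nonpos) linarith+
      moreover have "0 \<le> y" "0 \<le> z" unfolding y_def z_def using \<alpha> t1 by auto
      \<comment> \<open>The positive root of \<open>8 * t^2 + t - 5\<close> is about 0.7305, just
        below the range of \<open>t\<close>.\<close>
      moreover have "5 - t - 8 * t^2 \<le> 0"
        using t1 mult_mono[of "731 / 1000" t "731 / 1000" t] by (simp add: power2_eq_square)
      ultimately have "6 * ((5 - t - 8 * t^2) + x - y - z) \<le> 0" by simp
      with eq show ?thesis by (rule ord_eq_le_trans)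
    qed
    \<comment> \<open>\<open>c * ?d t - ?n t\<close> is affine in \<open>c\<close>; \<open>n\<close>
      settles its sign at \<open>c = 0\<close>, and this settles it at
      \<open>c = 5 / 14\<close>.\<close>
    have nd: "14 * ?n t - 5 * ?d t \<le> 0"
    proof -
      define x y z where "x = \<alpha> * (84 - 198 * t - 2016 * t^2 + 1200 * t^3)"
        and "y = \<alpha>^2 * (- 216 - 2016 * t^2 + 1200 * t^3)" and "z = \<alpha>^3 * (- 216 * t - 672 * t^2 + 400 * t^3)"
      have eq: "14 * ?n t - 5 * ?d t = (310 - 414 * t - 672 * t^2 + 400 * t^3) + x + y + z"
        by (simp add: x_def y_def z_def algebra_simps eval_nat_numeral)
      have "x \<le> 0" unfolding x_def using \<alpha> t1 t2 t3 by (intro mult_nonneg_nonpos) linarith+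
      moreover have "y \<le> 0" unfolding y_def using \<alpha> t1 t2 t3 by (intro mult_nonneg_nonpos) (simp, linarith)
      moreover have "z \<le> 0" unfolding z_def using \<alpha> t1 t2 t3 by (intro mult_nonneg_nonpos) (simp, linarith)
      moreover have "310 - 414 * t - 672 * t^2 + 400 * t^3 \<le> 0" using t1 t2 t3 by linarith
      ultimately have "(310 - 414 * t - 672 * t^2 + 400 * t^3) + x + y + z \<le> 0" by simp
      with eq show ?thesis by (rule ord_eq_le_trans)
    qed
    have "0 \<le> c * d - n" if "n \<le> 0" "14 * n - 5 * d \<le> 0" for n d :: real
    proof (cases "0 \<le> d")
      case True
      then have "0 \<le> c * d" using c by simp
      then show ?thesis using that by linarith
    next
      case False
      then have "5 / 14 * d \<le> c * d" using c by (intro mult_right_mono_neg) auto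
      then show ?thesis using that by linarith
    qed
    from this[OF n nd] show ?thesis .
  qed
qed auto

text \<open>The value at \<open>\<alpha> = 0\<close> is an upper bound; it supplies the range of
  \<open>c\<close> for \<open>c_beta_concave\<close>.\<close>

lemma c_one_le:
  assumes "0 \<le> \<alpha>" "\<alpha> \<le> 0.212" shows "c_one \<alpha> \<le> 5 / 14"
proof -
  have "0 < c_beta_den \<alpha> 1" using c_beta_den_pos[of 1 \<alpha>] assms by simp
  moreover have "c_beta_den \<alpha> 1 = 14 - 9 * \<alpha> - 24 * \<alpha>^2 - 8 * \<alpha>^3" by (simp add: c_beta_den_def)
  ultimately show ?thesis using assms unfolding c_one_def by (simp add: field_simps)
qed

text \<open>In terms of \<open>c = a / p\<close> and \<open>\<eta> = b / a\<close>, the difference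
  of the two sides is \<open>a^4 * p\<close> times
  \<open>c_beta_num \<alpha> \<eta> - c * c_beta_den \<alpha> \<eta>\<close>. By concavity it is
  enough that this margin is nonnegative at \<open>\<eta> = \<beta>\<close> and
  \<open>\<eta> = 1\<close>, which is what the two upper bounds on \<open>a\<close> say.\<close>

lemma density_inequality:
  fixes \<alpha> \<beta> a b p :: real
  assumes \<beta>: "0.731 \<le> \<beta>" "\<beta> \<le> 1" and \<alpha>: "0 \<le> \<alpha>" "\<alpha> \<le> 0.212" and pos: "0 < a" "0 < p"
    and b: "\<beta> * a \<le> b" "b \<le> a" and le: "a \<le> min (c_one \<alpha>) (c_beta \<alpha> \<beta>) * p"
  defines "S \<equiv> a + (1 + \<alpha>) * b"
  shows "S * ((2 * S - 3 * a)^2 * b * (p - b) + (2 * S - 3 * b)^2 * a * (p - a)) \<le> 9 * a^2 * b^2 * (p - S)"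
proof -
  define c \<eta> where "c = a / p" and "\<eta> = b / a"
  have eqs: "a = c * p" "b = \<eta> * a" using pos by (auto simp: c_def \<eta>_def)
  have "c \<le> min (c_one \<alpha>) (c_beta \<alpha> \<beta>)" using le pos unfolding c_def by (subst pos_divide_le_eq) auto
  then have c1: "c \<le> c_one \<alpha>" and c2: "c \<le> c_beta \<alpha> \<beta>" by auto
  have c0: "0 \<le> c" using pos by (simp add: c_def)
  have c3: "c \<le> 5 / 14" using c1 c_one_le[OF \<alpha>] by simp
  have \<eta>: "\<beta> \<le> \<eta>" "\<eta> \<le> 1" using b pos by (auto simp: \<eta>_def field_simps)
  define h where "h t = c * c_beta_den \<alpha> t - c_beta_num \<alpha> t" for t
  have h: "h 1 \<le> 0" "h \<beta> \<le> 0"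
    using c1 c2 c_beta_den_pos[of 1 \<alpha>] c_beta_den_pos[OF \<beta> \<alpha>] \<alpha>
    by (auto simp: c_one_eq c_beta_eq h_def field_simps)
  have "h \<eta> \<le> max (h \<beta>) (h 1)"
  proof -
    have "convex_on {0.731..1} h" using c_beta_concave[OF \<alpha> c0 c3] unfolding h_def .
    then have "convex_on {\<beta>..1} h" using \<beta> by (rule_tac convex_on_subset) auto
    then show ?thesis using convex_on_le_max[of \<beta> 1 h \<eta>] \<eta> by (auto simp: max_def)
  qed
  then have "0 \<le> c_beta_num \<alpha> \<eta> - c * c_beta_den \<alpha> \<eta>" using h by (simp add: h_def)
  then have "0 \<le> a^4 * p * (c_beta_num \<alpha> \<eta> - c * c_beta_den \<alpha> \<eta>)" using pos by simp
  also have "\<dots> = 9 * a^2 * b^2 * (p - S) - S * ((2 * S - 3 * a)^2 * b * (p - b) + (2 * S - 3 * b)^2 * a * (p - a))"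
  proof -
    define \<sigma> where "\<sigma> = 1 + (1 + \<alpha>) * \<eta>"
    have S: "S = \<sigma> * a" unfolding S_def eqs(2) \<sigma>_def by (simp add: algebra_simps)
    have ap: "a = c * p" by (rule eqs)
    have eq: "p - S = p * (1 - \<sigma> * c)" "p - b = p * (1 - \<eta> * c)" "p - a = p * (1 - c)"
      unfolding S eqs(2) using ap by (simp_all add: algebra_simps)
    show ?thesis unfolding c_beta_identity \<sigma>_def[symmetric] eq unfolding S eqs(2)
      by (simp add: algebra_simps eval_nat_numeral)
  qed
  finally show ?thesis by simp
qed

section \<open>The main theorem\<close>

text \<open>The minima are subtracted and the gcd \<open>g\<close> of all differences is divided
  out. Two distinct elements of \<open>A\<close> make \<open>g\<close> nonzero, and
  \<open>g \<le> q\<close> later makes it invertible modulo the prime.\<close>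

lemma normalize_int_sets:
  fixes A B :: "int set"
  assumes A: "A \<subseteq> {x..x + q}" "1 < card A" and B: "B \<subseteq> {y..y + q}" "B \<noteq> {}"
  shows "\<exists>g a b l m A' B'. 0 < g \<and> g \<le> q \<and> A = (\<lambda>n. a + g * n) ` A' \<and> B = (\<lambda>n. b + g * n) ` B' \<and>
    A' \<subseteq> {0..l} \<and> 0 \<in> A' \<and> l \<in> A' \<and> B' \<subseteq> {0..m} \<and> 0 \<in> B' \<and> m \<in> B' \<and>
    l \<le> q \<and> m \<le> q \<and> Gcd (A' \<union> B') = 1"
proof -
  have fin: "finite A" "finite B" using A(1) B(1) by (auto intro: finite_subset)
  have ne: "A \<noteq> {}" using A(2) by auto
  define a b where "a = Min A" and "b = Min B"
  have ab: "a \<in> A" "b \<in> B" "\<And>n. n \<in> A \<Longrightarrow> a \<le> n" "\<And>n. n \<in> B \<Longrightarrow> b \<le> n"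
    unfolding a_def b_def using fin ne B(2) by (simp_all add: Min_le)
  define D where "D = (\<lambda>n. n - a) ` A \<union> (\<lambda>n. n - b) ` B"
  define g where "g = Gcd D"
  have "\<exists>n\<in>A. n \<noteq> a"
  proof (rule ccontr)
    assume "\<not> ?thesis"
    then have "A = {a}" using ab(1) by blast
    then show False using A(2) by simp
  qed
  then obtain n where n: "n \<in> A" "n \<noteq> a" by auto
  have "n - a \<in> D" using n by (auto simp: D_def)
  then have gn: "g dvd n - a" unfolding g_def by (rule Gcd_dvd)
  have g0: "0 \<le> g" unfolding g_def by (rule Gcd_int_greater_eq_0)
  have "g \<noteq> 0" using gn n(2) by auto
  then have g: "0 < g" using g0 by simp
  have "g \<le> n - a" using gn n ab(3)[OF n(1)] by (intro zdvd_imp_le) auto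
  moreover have "n - a \<le> q" using subsetD[OF A(1) n(1)] subsetD[OF A(1) ab(1)] by simp
  ultimately have gq: "g \<le> q" by simp
  have dvd: "g dvd d" if "d \<in> D" for d unfolding g_def using that by (rule Gcd_dvd)
  define A' B' where "A' = (\<lambda>n. (n - a) div g) ` A" and "B' = (\<lambda>n. (n - b) div g) ` B"
  have A_eq: "A = (\<lambda>n. a + g * n) ` A'"
    unfolding A'_def image_image using dvd by (force simp: D_def)
  have B_eq: "B = (\<lambda>n. b + g * n) ` B'"
    unfolding B'_def image_image using dvd by (force simp: D_def)
  have fin': "finite A'" "finite B'" "A' \<noteq> {}" "B' \<noteq> {}" using fin ne B(2) by (auto simp: A'_def B'_def)
  have pos: "0 \<le> n" if "n \<in> A' \<union> B'" for n
    using that ab(3,4) g by (auto simp: A'_def B'_def pos_imp_zdiv_nonneg_iff)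
  have bound: "n \<le> q" if "n \<in> A' \<union> B'" for n
  proof -
    have "g * n \<le> q"
    proof (cases "n \<in> A'")
      case True
      then have "a + g * n \<in> A" unfolding A_eq by blast
      from subsetD[OF A(1) this] subsetD[OF A(1) ab(1)] show ?thesis by simp
    next
      case False
      then have "b + g * n \<in> B" using that unfolding B_eq by blast
      from subsetD[OF B(1) this] subsetD[OF B(1) ab(2)] show ?thesis by simp
    qed
    moreover have "1 * n \<le> g * n" using g pos[OF that] by (intro mult_right_mono) auto
    ultimately show ?thesis by simp
  qed
  have zero: "0 \<in> A'" "0 \<in> B'" using ab(1,2) by (force simp: A'_def B'_def)+
  have "Gcd (A' \<union> B') = 1"
  proof -
    let ?d = "Gcd (A' \<union> B')"
    have "?d * g dvd d" if "d \<in> D" for d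
    proof -
      have "d div g \<in> A' \<union> B'" using that by (auto simp: D_def A'_def B'_def)
      then have "?d dvd d div g" by (rule Gcd_dvd)
      then have "?d * g dvd (d div g) * g" by (rule mult_dvd_mono) simp
      then show ?thesis using dvd[OF that] by simp
    qed
    then have "?d * g dvd g" unfolding g_def[symmetric] by (subst (2) g_def) (rule Gcd_greatest)
    then have "?d dvd 1" using g by (metis dvd_times_right_cancel_iff less_irrefl mult_1)
    moreover have "0 \<le> ?d" by (rule Gcd_int_greater_eq_0)
    ultimately show ?thesis by (simp add: zdvd1_eq)
  qed
  moreover have "A' \<subseteq> {0..Max A'}" "B' \<subseteq> {0..Max B'}" "Max A' \<in> A'" "Max B' \<in> B'"
    using fin' pos by auto
  moreover have "Max A' \<le> q" "Max B' \<le> q" using bound calculation by auto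
  ultimately show ?thesis using g gq A_eq B_eq zero by blast
qed

text \<open>Undoing the dilation turns step 1 into step \<open>1 / \<kappa>\<close>, the same for
  every set; \<open>{0..h}\<close> has \<open>h + 1\<close> elements.\<close>

lemma arith_prog_dilate:
  fixes X :: "'p::prime_card mod_ring set"
  assumes "\<kappa> \<noteq> 0" "(*) \<kappa> ` X \<subseteq> (\<lambda>n. \<alpha> + of_nat n) ` {0..h}"
  shows "\<exists>P. arith_prog (1 / \<kappa>) P \<and> X \<subseteq> P \<and> card P \<le> h + 1"
proof (intro exI conjI)
  let ?P = "(\<lambda>i. \<alpha> / \<kappa> + of_nat i * (1 / \<kappa>)) ` {0..h}"
  show "arith_prog (1 / \<kappa>) ?P"
    unfolding arith_prog_def by (intro exI[of _ "\<alpha> / \<kappa>"] exI[of _ "h + 1"]) auto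
  show "X \<subseteq> ?P"
  proof
    fix x assume "x \<in> X"
    then obtain n where "n \<in> {0..h}" "\<kappa> * x = \<alpha> + of_nat n" using assms(2) by blast
    then have "x = \<alpha> / \<kappa> + of_nat n * (1 / \<kappa>)" using assms(1) by (simp add: field_simps)
    then show "x \<in> ?P" using \<open>n \<in> {0..h}\<close> by blast
  qed
  show "card ?P \<le> h + 1" using card_image_le[of "{0..h}"] by fastforce
qed

theorem theorem3p3:
  fixes A B C :: "'p::prime_card mod_ring set"
    and \<alpha> \<beta> :: real
    and r :: int
  assumes "0.731 \<le> \<beta>" and "\<beta> \<le> 1"
    and "0 < \<alpha>" and "\<alpha> \<le> 0.212"
    and "A \<noteq> {}" and "B \<noteq> {}"
    and "C = uminus ` (UNIV - (A + B))"
    and "int (card (A + B)) = int (card A) + int (card B) + r"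
    and "real (card (A + B)) \<le> real (card A) + (1 + \<alpha>) * real (card B) - 3"
    and "\<beta> * real (card A) \<le> real (card B)"
    and "card B \<le> card A"
    and "real (card A) \<le> min (c_one \<alpha>) (c_beta \<alpha> \<beta>) * real CARD('p)"
  shows "\<exists>d P\<^sub>A P\<^sub>B P\<^sub>C.
           arith_prog d P\<^sub>A \<and> arith_prog d P\<^sub>B \<and> arith_prog d P\<^sub>C \<and>
           A \<subseteq> P\<^sub>A \<and> int (card P\<^sub>A) \<le> int (card A) + r + 1 \<and>
           B \<subseteq> P\<^sub>B \<and> int (card P\<^sub>B) \<le> int (card B) + r + 1 \<and>
           C \<subseteq> P\<^sub>C \<and> int (card P\<^sub>C) \<le> int (card C) + r + 1"
proof -
  define a b s p where "a = real (card A)" and "b = real (card B)" and "s = real (card (A + B))" and "p = real CARD('p)"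
  define S where "S = a + (1 + \<alpha>) * b"
  have pos: "1 \<le> a" "1 \<le> b" "0 < p"
    using assms(5,6) by (simp_all add: a_def b_def p_def Suc_le_eq card_gt_0_iff)
  have ba: "b \<le> a" using assms(11) by (simp add: a_def b_def)
  have sS: "s + 3 \<le> S" using assms(9) by (simp add: s_def S_def a_def b_def)
  have ap: "14 * a \<le> 5 * p"
  proof -
    have "a \<le> min (c_one \<alpha>) (c_beta \<alpha> \<beta>) * p" using assms(12) by (simp add: a_def p_def)
    also have "\<dots> \<le> 5 / 14 * p" using c_one_le[of \<alpha>] assms(3,4) pos by (intro mult_right_mono) auto
    finally show ?thesis by simp
  qed
  have \<alpha>b: "0 \<le> \<alpha> * b" "\<alpha> * b \<le> 53 / 250 * b"
    using assms(3,4) pos by (auto intro!: mult_right_mono)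
  have S_eq: "S = a + b + \<alpha> * b" by (simp add: S_def algebra_simps)
  have S_le: "S \<le> a + 303 / 250 * b" using \<alpha>b(2) unfolding S_eq by simp
  have density: "S * ((2 * S - 3 * a)^2 * b * (p - b) + (2 * S - 3 * b)^2 * a * (p - a)) \<le> 9 * a^2 * b^2 * (p - S)"
    unfolding S_def by (rule density_inequality[of \<beta>]) (use assms pos ba in \<open>auto simp: a_def b_def p_def\<close>)
  \<comment> \<open>The thresholds satisfy \<open>(u + a) / 2 = S / 3\<close> and
    \<open>(v + b) / 2 = S / 3\<close>, so a half circle will hold more than \<open>S / 3\<close>
    elements of each set.\<close>
  define u v where "u = (2 * S - 3 * a) / 3" and "v = (2 * S - 3 * b) / 3"
  define E where "E = u\<^sup>2 * (b * (p - b)) + v\<^sup>2 * (a * (p - a))"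
  have "0 \<le> E" unfolding E_def using pos ap ba by (intro add_nonneg_nonneg mult_nonneg_nonneg) auto
  have SE: "S * E \<le> (a * b)\<^sup>2 * (p - S)"
  proof -
    have uv: "(2 * S - 3 * a)^2 = 9 * u\<^sup>2" "(2 * S - 3 * b)^2 = 9 * v\<^sup>2"
      by (simp_all add: u_def v_def power_divide)
    have "9 * (S * E) = S * ((2 * S - 3 * a)^2 * b * (p - b) + (2 * S - 3 * b)^2 * a * (p - a))"
      unfolding uv E_def by (simp add: algebra_simps)
    also have "\<dots> \<le> 9 * ((a * b)\<^sup>2 * (p - S))" using density by (simp add: power_mult_distrib mult.assoc)
    finally show ?thesis by simp
  qed
  have S0: "0 \<le> S" "0 \<le> s" using pos \<alpha>b by (auto simp: S_eq s_def)
  then have "0 \<le> (a * b)\<^sup>2 * (p - S)" using SE \<open>0 \<le> E\<close> by (meson mult_nonneg_nonneg order_trans)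
  moreover have ab2: "0 < (a * b)\<^sup>2" using pos by simp
  ultimately have Sp: "S \<le> p" by (simp add: zero_le_mult_iff)
  then have sp: "s < p" using sS by simp
  \<comment> \<open>The inequality at \<open>S\<close> becomes strict at \<open>s\<close>, because
    \<open>s < S\<close>.\<close>
  have "E * (s * (p - s)) < (a * b * (p - s))\<^sup>2"
  proof -
    have "E * s \<le> S * E" using sS \<open>0 \<le> E\<close> by (simp add: mult.commute mult_left_mono)
    also have "\<dots> \<le> (a * b)\<^sup>2 * (p - S)" by (rule SE)
    also have "\<dots> < (a * b)\<^sup>2 * (p - s)" using ab2 sS by (intro mult_strict_left_mono) auto
    finally have "E * s * (p - s) < (a * b)\<^sup>2 * (p - s) * (p - s)" using sp by (intro mult_strict_right_mono) auto
    then show ?thesis by (simp add: power2_eq_square algebra_simps)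
  qed
  from large_fourier_coefficients[OF this[unfolded E_def a_def b_def s_def p_def]]
  obtain k where k: "k \<noteq> 0" "u < norm (fourier A k)" "v < norm (fourier B k)"
    by (auto simp: a_def b_def p_def)
  define q where "q = (int CARD('p) - 1) div 2"
  have "2 < CARD('p)" using ap pos by (simp add: p_def)
  then have odd: "odd CARD('p)" using prime_card[where 'a = 'p] prime_odd_nat by blast
  obtain x where x: "norm (fourier A k) + card A \<le> 2 * card {n \<in> {x..x + q}. of_int n \<in> (*) k ` A}"
    using arc_count[OF k(1) odd] unfolding q_def by blast
  obtain y where y: "norm (fourier B k) + card B \<le> 2 * card {n \<in> {y..y + q}. of_int n \<in> (*) k ` B}"
    using arc_count[OF k(1) odd] unfolding q_def by blast
  define A1 B1 where "A1 = {n \<in> {x..x + q}. of_int n \<in> (*) k ` A}" and "B1 = {n \<in> {y..y + q}. of_int n \<in> (*) k ` B}"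
  have A1: "S < 3 * real (card A1)" using x k(2) by (simp add: A1_def u_def a_def field_simps)
  have B1: "S < 3 * real (card B1)" using y k(3) by (simp add: B1_def v_def b_def field_simps)
  have s_ge: "a \<le> s"
  proof -
    obtain e where "e \<in> B" using assms(6) by auto
    then have "(\<lambda>x. x + e) ` A \<subseteq> A + B" by (auto intro: set_plus_intro)
    then have "card ((\<lambda>x. x + e) ` A) \<le> card (A + B)" by (intro card_mono) auto
    then show ?thesis by (simp add: card_image a_def s_def)
  qed
  \<comment> \<open>\<open>a \<le> s\<close> and \<open>s + 3 \<le> S\<close> give
    \<open>(1 + \<alpha>) * b \<ge> 3\<close>, which excludes \<open>b = 1\<close>.\<close>
  have b2: "2 \<le> b"
  proof -
    have "1 < b" using s_ge sS \<alpha>b unfolding S_eq by linarith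
    then show ?thesis by (simp add: b_def)
  qed
  have "A1 \<subseteq> {x..x + q}" "B1 \<subseteq> {y..y + q}" by (auto simp: A1_def B1_def)
  moreover have "1 < card A1"
  proof -
    have "3 < 3 * real (card A1)" using A1 pos b2 \<alpha>b unfolding S_eq by linarith
    then show ?thesis by simp
  qed
  moreover have "B1 \<noteq> {}"
  proof
    assume "B1 = {}"
    then show False using B1 S0 by simp
  qed
  ultimately obtain g a0 b0 l m A' B' where g: "0 < g" "g \<le> q"
    and im: "A1 = (\<lambda>n. a0 + g * n) ` A'" "B1 = (\<lambda>n. b0 + g * n) ` B'"
    and A': "A' \<subseteq> {0..l}" "0 \<in> A'" "l \<in> A'" and B': "B' \<subseteq> {0..m}" "0 \<in> B'" "m \<in> B'"
    and lm: "l \<le> q" "m \<le> q" and gcd: "Gcd (A' \<union> B') = 1"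
    using normalize_int_sets[of A1 x q B1 y] by blast
  have card': "card A' = card A1" "card B' = card B1"
    unfolding im using g by (simp_all add: card_image inj_on_def)
  define \<gamma> where "\<gamma> = (of_int g :: 'p mod_ring)"
  have "\<gamma> \<noteq> 0"
  proof
    assume "\<gamma> = 0"
    then have "(of_int g :: 'p mod_ring) = of_int 0" by (simp add: \<gamma>_def)
    then have "g mod int CARD('p) = 0" by (simp only: of_int_mod_ring_eq_iff) simp
    moreover have "g < int CARD('p)" using g unfolding q_def by linarith
    ultimately show False using g by simp
  qed
  \<comment> \<open>The dilation \<open>k\<close> from the Fourier argument is combined with
    division by the common step \<open>g\<close> of the integer sets.\<close>
  define \<kappa> where "\<kappa> = k / \<gamma>"
  have \<kappa>: "\<kappa> \<noteq> 0" using k(1) \<open>\<gamma> \<noteq> 0\<close> by (simp add: \<kappa>_def)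
  have lift: "of_int ` X' \<subseteq> (\<lambda>x. x - of_int c / \<gamma>) ` (*) \<kappa> ` X"
    if "\<And>n. n \<in> X' \<Longrightarrow> of_int (c + g * n) \<in> (*) k ` X" for X' c and X :: "'p mod_ring set"
  proof clarify
    fix n assume "n \<in> X'"
    from that[OF this] obtain z where z: "z \<in> X" "of_int (c + g * n) = k * z" by auto
    then have "of_int n = \<kappa> * z - of_int c / \<gamma>" using \<open>\<gamma> \<noteq> 0\<close>
      by (simp add: \<kappa>_def \<gamma>_def[symmetric] field_simps)
    then show "of_int n \<in> (\<lambda>x. x - of_int c / \<gamma>) ` (*) \<kappa> ` X" using z(1) by blast
  qed
  have liftA: "of_int ` A' \<subseteq> (\<lambda>x. x - of_int a0 / \<gamma>) ` (*) \<kappa> ` A"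
  proof (rule lift)
    fix n assume "n \<in> A'"
    then have "a0 + g * n \<in> A1" unfolding im by blast
    then show "of_int (a0 + g * n) \<in> (*) k ` A" unfolding A1_def by blast
  qed
  have liftB: "of_int ` B' \<subseteq> (\<lambda>x. x - of_int b0 / \<gamma>) ` (*) \<kappa> ` B"
  proof (rule lift)
    fix n assume "n \<in> B'"
    then have "b0 + g * n \<in> B1" unfolding im by blast
    then show "of_int (b0 + g * n) \<in> (*) k ` B" unfolding B1_def by blast
  qed
  have sum: "(*) \<kappa> ` A + (*) \<kappa> ` B = (*) \<kappa> ` (A + B)"
    by (force simp: set_plus_def image_iff ring_distribs)
  have inj: "inj_on ((*) \<kappa>) X" for X using \<kappa> by (simp add: inj_on_def)
  then have card_\<kappa>: "card ((*) \<kappa> ` X) = card X" for X by (simp add: card_image)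
  have "range ((*) \<kappa>) = UNIV" using inj[of UNIV] by (simp add: finite_UNIV_inj_surj)
  then have "UNIV - (*) \<kappa> ` (A + B) = (*) \<kappa> ` (UNIV - (A + B))"
    using image_set_diff[OF inj[of UNIV], of UNIV "A + B"] by simp
  then have C: "(*) \<kappa> ` C = uminus ` (UNIV - ((*) \<kappa> ` A + (*) \<kappa> ` B))"
    unfolding assms(7) sum by (simp add: image_image)
  have cC: "card C + card (A + B) = CARD('p)"
    using card_mono[of UNIV "A + B"] unfolding assms(7) by (simp add: card_image card_Diff_subset)
  have cC': "real (card C) = p - s" using cC by (simp add: p_def s_def flip: of_nat_add)
  have lm': "l + m < int CARD('p)" using lm unfolding q_def by linarith
  \<comment> \<open>Here the 3 in the hypothesis is used:
    \<open>s + 3 \<le> S < 3 * card A'\<close>, and likewise for \<open>B'\<close>, so both triples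
    are at least \<open>s + 4\<close> by integrality.\<close>
  have small: "card ((*) \<kappa> ` A + (*) \<kappa> ` B) + 4 \<le> card A' + card B' + min (card A') (card B')"
  proof -
    have "s + 3 < 3 * real (card A')" "s + 3 < 3 * real (card B')" using A1 B1 sS card' by auto
    then show ?thesis unfolding sum card_\<kappa> s_def by linarith
  qed
  have C_ne: "(*) \<kappa> ` C \<noteq> {}" using cC' sp by auto
  have small1: "CARD('p) + 4 \<le> card ((*) \<kappa> ` B) + card A' + 2 * card ((*) \<kappa> ` C)"
  proof -
    have "p + 4 \<le> b + real (card A') + 2 * p - 2 * s" using A1 sS S_le ap ba pos unfolding card' by linarith
    then have "real (CARD('p) + 4) \<le> real (card B + card A' + 2 * card C)" by (simp add: cC' p_def b_def)
    then show ?thesis unfolding card_\<kappa> by (simp only: of_nat_le_iff)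
  qed
  have small2: "CARD('p) + 4 \<le> card ((*) \<kappa> ` A) + 2 * card ((*) \<kappa> ` B) + card ((*) \<kappa> ` C)"
  proof -
    have "p + 4 \<le> a + 2 * b + (p - s)" using sS \<alpha>b b2 unfolding S_eq by linarith
    then have "real (CARD('p) + 4) \<le> real (card A + 2 * card B + card C)" by (simp add: cC' p_def a_def b_def)
    then show ?thesis unfolding card_\<kappa> by (simp only: of_nat_le_iff)
  qed
  have small3: "CARD('p) + 4 \<le> card ((*) \<kappa> ` A) + card ((*) \<kappa> ` B) + 2 * card ((*) \<kappa> ` C)"
  proof -
    have "p + 4 \<le> a + b + 2 * p - 2 * s" using sS S_le ap ba pos by linarith
    then have "real (CARD('p) + 4) \<le> real (card A + card B + 2 * card C)" by (simp add: cC' p_def a_def b_def)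
    then show ?thesis unfolding card_\<kappa> by (simp only: of_nat_le_iff)
  qed
  note rect = rectification[OF A' liftA B' liftB lm' gcd small C C_ne small1 small2 small3, unfolded card_\<kappa>]
  have AP: "\<exists>P. arith_prog (1 / \<kappa>) P \<and> X \<subseteq> P \<and> card P + (M + N) \<le> CARD('p) + 1"
    if ex: "\<exists>\<alpha> h. (*) \<kappa> ` X \<subseteq> (\<lambda>n. \<alpha> + of_nat n) ` {0..h} \<and> h + M + N \<le> CARD('p)" for X M N
  proof -
    obtain \<alpha> h where h: "(*) \<kappa> ` X \<subseteq> (\<lambda>n. \<alpha> + of_nat n) ` {0..h}" "h + M + N \<le> CARD('p)"
      using ex by blast
    from arith_prog_dilate[OF \<kappa> h(1)] obtain P where "arith_prog (1 / \<kappa>) P" "X \<subseteq> P" "card P \<le> h + 1" by blast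
    then show ?thesis using h(2) by (intro exI[of _ P]) simp
  qed
  obtain PA where PA: "arith_prog (1 / \<kappa>) PA" "A \<subseteq> PA" "card PA + (card B + card C) \<le> CARD('p) + 1"
    using AP[OF rect(1)] by blast
  obtain PB where PB: "arith_prog (1 / \<kappa>) PB" "B \<subseteq> PB" "card PB + (card A + card C) \<le> CARD('p) + 1"
    using AP[OF rect(2)] by blast
  obtain PC where PC: "arith_prog (1 / \<kappa>) PC" "C \<subseteq> PC" "card PC + (card A + card B) \<le> CARD('p) + 1"
    using AP[OF rect(3)] by blast
  \<comment> \<open>Since \<open>CARD('p) - card C = card (A + B) = card A + card B + r\<close>, the
    three bounds take the required form.\<close>
  have "int (card PA) \<le> int (card A) + r + 1" "int (card PB) \<le> int (card B) + r + 1"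
    "int (card PC) \<le> int (card C) + r + 1"
    using PA(3) PB(3) PC(3) cC assms(8) by linarith+
  then show ?thesis using PA PB PC by blast
qed

end
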